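(* Let $F$ be a normed lattice with closed unit ball $B_F$ and universal completion $F^u$. The following conditions are equivalent: (i) $F$ is pointwise demicontinuous; (ii) the common order and uo adherence of $B_F$ in $F^u$ is radially bounded; (iii) the common order and uo adherence of $B_F$ in $F$ is radially bounded; (iv) every (upward) directed subset of $B_F\cap F_+$ is dominable.
   Context: A normed lattice is a real vector lattice with a lattice (solid) norm; norm completeness is not assumed. $P\uparrow f$ ($P\downarrow f$) means that $P$ is upward (downward) directed with supremum (infimum) $f$. A net $(f_p)$ in a vector lattice $G$ order converges to $f$ if there is $Q\subset G$ with $Q\downarrow 0$ such that for every $q\in Q$ there is $p_q$ with $|f_p-f|\le q$ whenever $p\ge p_q$. It uo converges to $f$ if $|f_p-f|\wedge e$ order converges to $0$ for every $e\in G_+$. The order (uo) adherence of a set in $G$ is the set of all order (uo) limits in $G$ of nets of its elements. For the set $B_F$, the order and uo adherences coincide, both in $F$ and in $F^u$. A sublattice $E$ of $G$ is order dense if for every $0<g\in G$ there is $e\in E$ with $0<e\le g$. The universal completion $F^u$ is the (essentially unique) universally complete vector lattice, i.e. order (Dedekind) complete and such that every disjoint set of positive elements is order bounded, that contains $F$ as an order dense sublattice. A subset of $F$ is dominable if it is order bounded in $F^u$. A convex balanced set $B$ in a vector space is radially bounded if for every nonzero vector $e$ there is $n\in\mathbb{N}$ with $ne\notin B$. $F$ is pointwise demicontinuous if for every $0<f\in F$ there is $t>0$ such that whenever $P\subset s(B_F\cap F_+)$ satisfies $P\uparrow f$, then $s\ge t$. *)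

theory Defs
  imports "HOL-Analysis.Analysis" "HOL-Library.Lattice_Algebras" "HOL-Library.Lub_Glb"
begin

section \<open>Vector lattices and normed lattices\<close>

class vector_lattice = ordered_real_vector + lattice_ab_group_add_abs

class normed_lattice = vector_lattice + real_normed_vector +
  assumes norm_solid: "\<bar>x\<bar> \<le> \<bar>y\<bar> \<Longrightarrow> norm x \<le> norm y"

instance real :: normed_lattice
  by standard (auto simp: sup_real_def max_def)

class universally_complete_vector_lattice = vector_lattice +
  assumes dedekind_complete:
      "A \<noteq> {} \<Longrightarrow> bdd_above A \<Longrightarrow>
         \<exists>s. (\<forall>a\<in>A. a \<le> s) \<and> (\<forall>u. (\<forall>a\<in>A. a \<le> u) \<longrightarrow> s \<le> u)"
    and disjoint_bdd_above:
      "(\<forall>d\<in>D. 0 \<le> d) \<Longrightarrow> pairwise (\<lambda>c d. inf c d = 0) D \<Longrightarrow> bdd_above D"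

instance real :: universally_complete_vector_lattice
proof
  fix A :: "real set" assume "A \<noteq> {}" "bdd_above A"
  then show "\<exists>s. (\<forall>a\<in>A. a \<le> s) \<and> (\<forall>u. (\<forall>a\<in>A. a \<le> u) \<longrightarrow> s \<le> u)"
    by (intro exI[of _ "Sup A"]) (auto intro: cSup_upper cSup_least)
next
  fix D :: "real set"
  assume D: "\<forall>d\<in>D. 0 \<le> d" "pairwise (\<lambda>c d. inf c d = 0) D"
  show "bdd_above D"
  proof (cases "\<exists>c\<in>D. c > 0")
    case True
    then obtain c where c: "c \<in> D" "c > 0" by blast
    have "d \<le> c" if "d \<in> D" for d
      using D c that by (auto simp: pairwise_def inf_real_def min_def split: if_splits)
    then show ?thesis by (rule bdd_aboveI)
  next
    case False
    then show ?thesis by (intro bdd_aboveI[of _ 0]) force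
  qed
qed

section \<open>Directed sets\<close>

definition upward_directed :: "'a::order set \<Rightarrow> bool" where
  "upward_directed P \<longleftrightarrow> P \<noteq> {} \<and> (\<forall>x\<in>P. \<forall>y\<in>P. \<exists>z\<in>P. x \<le> z \<and> y \<le> z)"

definition downward_directed :: "'a::order set \<Rightarrow> bool" where
  "downward_directed P \<longleftrightarrow> P \<noteq> {} \<and> (\<forall>x\<in>P. \<forall>y\<in>P. \<exists>z\<in>P. z \<le> x \<and> z \<le> y)"

definition up_to :: "'a::order set \<Rightarrow> 'a \<Rightarrow> bool"  (infix \<open>\<up>\<close> 50) where
  "P \<up> f \<longleftrightarrow> upward_directed P \<and> isLub UNIV P f"

definition down_to :: "'a::order set \<Rightarrow> 'a \<Rightarrow> bool"  (infix \<open>\<down>\<close> 50) where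
  "P \<down> f \<longleftrightarrow> downward_directed P \<and> isGlb UNIV P f"

section \<open>Order and uo convergence of nets\<close>

text \<open>A net is a function \<open>x\<close> restricted to an index set \<open>I\<close> that is directed by a
  preorder \<open>le\<close>.\<close>

definition net_index :: "'i set \<Rightarrow> ('i \<Rightarrow> 'i \<Rightarrow> bool) \<Rightarrow> bool" where
  "net_index I le \<longleftrightarrow> I \<noteq> {} \<and> reflp_on I le \<and> transp_on I le \<and>
     (\<forall>i\<in>I. \<forall>j\<in>I. \<exists>k\<in>I. le i k \<and> le j k)"

definition order_converges ::
  "'i set \<Rightarrow> ('i \<Rightarrow> 'i \<Rightarrow> bool) \<Rightarrow> ('i \<Rightarrow> 'g::vector_lattice) \<Rightarrow> 'g \<Rightarrow> bool" where
  "order_converges I le x f \<longleftrightarrow>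
     (\<exists>Q. Q \<down> 0 \<and> (\<forall>q\<in>Q. \<exists>i\<in>I. \<forall>j\<in>I. le i j \<longrightarrow> \<bar>x j - f\<bar> \<le> q))"

definition uo_converges ::
  "'i set \<Rightarrow> ('i \<Rightarrow> 'i \<Rightarrow> bool) \<Rightarrow> ('i \<Rightarrow> 'g::vector_lattice) \<Rightarrow> 'g \<Rightarrow> bool" where
  "uo_converges I le x f \<longleftrightarrow>
     (\<forall>e\<ge>0. order_converges I le (\<lambda>i. inf (\<bar>x i - f\<bar>) e) 0)"

text \<open>HOL cannot quantify over the type of the index set inside a formula, so the adherences
  are defined with index sets in the fixed type \<^typ>\<open>'g \<times> 'g set\<close> (a point of the net paired
  with a tail containing it). This loses nothing: lemmas \<open>order_adherenceI\<close> and \<open>uo_adherenceI\<close> below show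
  that limits of nets over arbitrary index types are captured.\<close>

definition order_adherence :: "'g::vector_lattice set \<Rightarrow> 'g set" where
  "order_adherence A = {f. \<exists>(I :: ('g \<times> 'g set) set) le x.
     net_index I le \<and> x ` I \<subseteq> A \<and> order_converges I le x f}"

definition uo_adherence :: "'g::vector_lattice set \<Rightarrow> 'g set" where
  "uo_adherence A = {f. \<exists>(I :: ('g \<times> 'g set) set) le x.
     net_index I le \<and> x ` I \<subseteq> A \<and> uo_converges I le x f}"

lemma net_tail_reindex:
  fixes I :: "'i set" and x :: "'i \<Rightarrow> 'g"
  assumes "net_index I le"
  obtains J :: "('g \<times> 'g set) set" and le' y where
    "net_index J le'" "y ` J \<subseteq> x ` I"
    "\<And>P. \<exists>i\<in>I. \<forall>j\<in>I. le i j \<longrightarrow> P (x j) \<Longrightarrow> \<exists>i\<in>J. \<forall>j\<in>J. le' i j \<longrightarrow> P (y j)"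
proof -
  define T where "T i = x ` {j \<in> I. le i j}" for i
  define J where "J = {(z, S). \<exists>i\<in>I. S = T i \<and> z \<in> S}"
  define le' :: "'g \<times> 'g set \<Rightarrow> 'g \<times> 'g set \<Rightarrow> bool" where "le' = (\<lambda>p q. snd q \<subseteq> snd p)"
  have ne: "I \<noteq> {}" and Ir: "reflp_on I le" and It: "transp_on I le"
    and dir: "\<And>i j. i \<in> I \<Longrightarrow> j \<in> I \<Longrightarrow> \<exists>k\<in>I. le i k \<and> le j k"
    using assms unfolding net_index_def by simp_all
  note refl = reflp_onD[OF Ir] and trans = transp_onD[OF It]
  have inJ: "(x i, T i) \<in> J" if "i \<in> I" for i
    using that refl by (auto simp: J_def T_def)
  have T_mono: "T k \<subseteq> T i" if "i \<in> I" "k \<in> I" "le i k" for i k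
    unfolding T_def using that trans[of i k] by blast
  have "net_index J le'"
    unfolding net_index_def
  proof (intro conjI ballI)
    show "J \<noteq> {}" using ne inJ by blast
    show "reflp_on J le'" "transp_on J le'"
      by (auto simp: le'_def intro!: reflp_onI transp_onI)
    fix p q assume "p \<in> J" "q \<in> J"
    then obtain i j where ij: "i \<in> I" "j \<in> I" "snd p = T i" "snd q = T j"
      by (auto simp: J_def)
    then obtain k where "k \<in> I" "le i k" "le j k" using dir by blast
    then show "\<exists>r\<in>J. le' p r \<and> le' q r"
      using ij inJ[of k] T_mono[of i k] T_mono[of j k]
      by (intro bexI[of _ "(x k, T k)"]) (simp_all add: le'_def)
  qed
  moreover have "fst ` J \<subseteq> x ` I" by (auto simp: J_def T_def)
  moreover have "\<exists>i\<in>J. \<forall>j\<in>J. le' i j \<longrightarrow> P (fst j)"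
    if "\<exists>i\<in>I. \<forall>j\<in>I. le i j \<longrightarrow> P (x j)" for P
  proof -
    from that obtain i where i: "i \<in> I" "\<And>z. z \<in> T i \<Longrightarrow> P z" by (auto simp: T_def)
    have "\<forall>j\<in>J. le' (x i, T i) j \<longrightarrow> P (fst j)"
      using i(2) by (auto simp: J_def le'_def)
    then show ?thesis using inJ[OF i(1)] by blast
  qed
  ultimately show thesis using that by blast
qed

lemma order_adherenceI:
  fixes I :: "'i set" and x :: "'i \<Rightarrow> 'g::vector_lattice"
  assumes I: "net_index I le" and x: "x ` I \<subseteq> A" and conv: "order_converges I le x f"
  shows "f \<in> order_adherence A"
proof -
  obtain J :: "('g \<times> 'g set) set" and le' y where J: "net_index J le'" "y ` J \<subseteq> x ` I"
    and ev: "\<And>P. \<exists>i\<in>I. \<forall>j\<in>I. le i j \<longrightarrow> P (x j) \<Longrightarrow> \<exists>i\<in>J. \<forall>j\<in>J. le' i j \<longrightarrow> P (y j)"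
    by (rule net_tail_reindex[OF I, where x = x]) (rule that)
  obtain Q where Q: "Q \<down> 0" "\<And>q. q \<in> Q \<Longrightarrow> \<exists>i\<in>I. \<forall>j\<in>I. le i j \<longrightarrow> \<bar>x j - f\<bar> \<le> q"
    using conv unfolding order_converges_def by blast
  have "order_converges J le' y f"
    unfolding order_converges_def
    by (intro exI[of _ Q] conjI ballI Q(1) ev[of "\<lambda>z. \<bar>z - f\<bar> \<le> q" for q] Q(2))
  then show ?thesis unfolding order_adherence_def using J x by blast
qed

lemma uo_adherenceI:
  fixes I :: "'i set" and x :: "'i \<Rightarrow> 'g::vector_lattice"
  assumes I: "net_index I le" and x: "x ` I \<subseteq> A" and conv: "uo_converges I le x f"
  shows "f \<in> uo_adherence A"
proof -
  obtain J :: "('g \<times> 'g set) set" and le' y where J: "net_index J le'" "y ` J \<subseteq> x ` I"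
    and ev: "\<And>P. \<exists>i\<in>I. \<forall>j\<in>I. le i j \<longrightarrow> P (x j) \<Longrightarrow> \<exists>i\<in>J. \<forall>j\<in>J. le' i j \<longrightarrow> P (y j)"
    by (rule net_tail_reindex[OF I, where x = x]) (rule that)
  have "uo_converges J le' y f"
    unfolding uo_converges_def
  proof (intro allI impI)
    fix e :: 'g assume "0 \<le> e"
    then obtain Q where Q: "Q \<down> 0"
      "\<And>q. q \<in> Q \<Longrightarrow> \<exists>i\<in>I. \<forall>j\<in>I. le i j \<longrightarrow> \<bar>inf (\<bar>x j - f\<bar>) e - 0\<bar> \<le> q"
      using conv unfolding uo_converges_def order_converges_def by blast
    show "order_converges J le' (\<lambda>i. inf (\<bar>y i - f\<bar>) e) 0"
      unfolding order_converges_def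
      by (intro exI[of _ Q] conjI ballI Q(1) ev[of "\<lambda>z. \<bar>inf (\<bar>z - f\<bar>) e - 0\<bar> \<le> q" for q] Q(2))
  qed
  then show ?thesis unfolding uo_adherence_def using J x by blast
qed

section \<open>Universal completion\<close>

definition lattice_embedding :: "('f::vector_lattice \<Rightarrow> 'g::vector_lattice) \<Rightarrow> bool" where
  "lattice_embedding \<iota> \<longleftrightarrow> linear \<iota> \<and> inj \<iota> \<and>
     (\<forall>x y. \<iota> (sup x y) = sup (\<iota> x) (\<iota> y)) \<and> (\<forall>x y. \<iota> (inf x y) = inf (\<iota> x) (\<iota> y))"

definition order_dense :: "'g::vector_lattice set \<Rightarrow> bool" where
  "order_dense E \<longleftrightarrow> (\<forall>g>0. \<exists>e\<in>E. 0 < e \<and> e \<le> g)"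

text \<open>The type \<open>'g\<close>, via \<open>\<iota>\<close>, is a (hence, up to isomorphism, the) universal completion of
  \<open>'f\<close>. Universal completeness of the codomain is enforced by its type class.\<close>

definition universal_completion ::
  "('f::vector_lattice \<Rightarrow> 'g::universally_complete_vector_lattice) \<Rightarrow> bool" where
  "universal_completion \<iota> \<longleftrightarrow> lattice_embedding \<iota> \<and> order_dense (range \<iota>)"

definition dominable ::
  "('f::vector_lattice \<Rightarrow> 'g::universally_complete_vector_lattice) \<Rightarrow> 'f set \<Rightarrow> bool" where
  "dominable \<iota> D \<longleftrightarrow> bdd_above (\<iota> ` D) \<and> bdd_below (\<iota> ` D)"

section \<open>Radial boundedness and pointwise demicontinuity\<close>

definition balanced :: "'a::real_vector set \<Rightarrow> bool" where
  "balanced B \<longleftrightarrow> (\<forall>r. \<bar>r\<bar> \<le> 1 \<longrightarrow> (\<lambda>x. r *\<^sub>R x) ` B \<subseteq> B)"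

definition radially_bounded :: "'a::real_vector set \<Rightarrow> bool" where
  "radially_bounded B \<longleftrightarrow> convex B \<and> balanced B \<and>
     (\<forall>e. e \<noteq> 0 \<longrightarrow> (\<exists>n::nat. real n *\<^sub>R e \<notin> B))"

definition pointwise_demicontinuous :: "'f::normed_lattice itself \<Rightarrow> bool" where
  "pointwise_demicontinuous _ \<longleftrightarrow>
     (\<forall>f::'f. 0 < f \<longrightarrow>
       (\<exists>t>0. \<forall>s P. P \<subseteq> (\<lambda>x. s *\<^sub>R x) ` (cball 0 1 \<inter> {0..}) \<and> P \<up> f \<longrightarrow> t \<le> s))"

section \<open>The order and uo adherences of the unit ball coincide\<close>

lemma isGlb_UNIV_iff:
  "isGlb UNIV Q f \<longleftrightarrow> (\<forall>q\<in>Q. f \<le> q) \<and> (\<forall>z. (\<forall>q\<in>Q. z \<le> q) \<longrightarrow> z \<le> (f::'a::order))"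
  by (auto simp: isGlb_def greatestP_def isLb_def setle_def setge_def)

lemma isLub_UNIV_iff:
  "isLub UNIV Q f \<longleftrightarrow> (\<forall>q\<in>Q. q \<le> f) \<and> (\<forall>z. (\<forall>q\<in>Q. q \<le> z) \<longrightarrow> f \<le> (z::'a::order))"
  by (auto simp: isLub_def leastP_def isUb_def setle_def setge_def)

definition trunc :: "'g::vector_lattice \<Rightarrow> 'g \<Rightarrow> 'g" where
  "trunc h x = sup (inf x h) (- h)"

lemma trunc_mono: "x \<le> y \<Longrightarrow> trunc h x \<le> trunc h y"
  unfolding trunc_def by (meson inf_mono order_refl sup_mono)

lemma trunc_le: "0 \<le> h \<Longrightarrow> trunc h x \<le> h" "- h \<le> trunc h x"
  unfolding trunc_def by (auto intro: order_trans[of _ 0])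

lemma abs_trunc_le: "0 \<le> h \<Longrightarrow> \<bar>trunc h x\<bar> \<le> \<bar>x\<bar>" for x :: "'g::vector_lattice"
proof -
  assume h: "0 \<le> h"
  have "- h \<le> \<bar>x\<bar>" "- \<bar>x\<bar> \<le> h"
    using h abs_ge_zero[of x] by (meson neg_le_0_iff_le order_trans)+
  moreover have "x \<le> \<bar>x\<bar>" "- \<bar>x\<bar> \<le> x"
    using abs_ge_self[of x] abs_ge_minus_self[of x] by (simp_all add: minus_le_iff)
  ultimately have "trunc h x \<le> \<bar>x\<bar>" "- \<bar>x\<bar> \<le> trunc h x"
    unfolding trunc_def by (simp_all add: le_infI1 le_supI1)
  then show ?thesis by (metis abs_leI minus_le_iff)
qed

lemma trunc_add_le: "0 \<le> d \<Longrightarrow> trunc h (x + d) \<le> trunc h x + d" for x :: "'g::vector_lattice"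
proof -
  assume d: "0 \<le> d"
  have "inf (x + d) h \<le> inf x h + d"
    using d by (simp add: add_inf_distrib_right le_infI2)
  then show ?thesis
    unfolding trunc_def using d by (simp add: add_sup_distrib_right le_supI1 le_supI2)
qed

lemma abs_trunc_diff_le: "\<bar>trunc h x - trunc h y\<bar> \<le> \<bar>x - y\<bar>" for x y :: "'g::vector_lattice"
proof -
  have *: "trunc h x - trunc h y \<le> \<bar>x - y\<bar>" for x y
  proof -
    have "x \<le> y + \<bar>x - y\<bar>" using abs_ge_self[of "x - y"] by (simp add: algebra_simps)
    then have "trunc h x \<le> trunc h y + \<bar>x - y\<bar>"
      using trunc_mono trunc_add_le abs_ge_zero order_trans by metis
    then show ?thesis by (simp add: algebra_simps)
  qed
  show ?thesis using *[of x y] *[of y x] by (intro abs_leI) (simp_all add: abs_minus_commute)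
qed

lemma abs_trunc_self_diff_le:
  fixes f :: "'g::vector_lattice"
  assumes "h \<le> \<bar>f\<bar>"
  shows "\<bar>trunc h f - f\<bar> \<le> \<bar>f\<bar> - h"
proof -
  let ?d = "\<bar>f\<bar> - h"
  have d: "0 \<le> ?d" using assms by simp
  have "f - ?d \<le> h" "f - ?d \<le> f"
    using abs_ge_self[of f] d by (simp_all add: algebra_simps)
  then have 1: "f - ?d \<le> trunc h f" unfolding trunc_def by (simp add: le_supI1)
  have "f \<le> f + ?d" using d by simp
  moreover have "- h \<le> f + ?d"
    using add_right_mono[OF abs_ge_minus_self[of f], of "f - h"] by (simp add: algebra_simps)
  ultimately have 2: "trunc h f \<le> f + ?d" unfolding trunc_def by (simp add: le_infI1)
  show ?thesis using 1 2 by (intro abs_leI) (simp_all add: algebra_simps)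
qed

lemma order_converges_imp_uo_converges:
  fixes x :: "'i \<Rightarrow> 'g::vector_lattice"
  assumes "order_converges I le x f"
  shows "uo_converges I le x f"
  unfolding uo_converges_def
proof (intro allI impI)
  fix e :: 'g assume e: "0 \<le> e"
  have "\<bar>inf (\<bar>a\<bar>) e - 0\<bar> \<le> \<bar>a\<bar>" for a :: 'g
    using e by (simp add: abs_of_nonneg)
  then show "order_converges I le (\<lambda>i. inf (\<bar>x i - f\<bar>) e) 0"
    using assms unfolding order_converges_def by (meson order_trans)
qed

lemma lattice_embedding_simps:
  assumes "lattice_embedding \<iota>"
  shows "\<iota> 0 = 0" "\<iota> (x + y) = \<iota> x + \<iota> y" "\<iota> (x - y) = \<iota> x - \<iota> y" "\<iota> (- x) = - \<iota> x"
    "\<iota> (sup x y) = sup (\<iota> x) (\<iota> y)" "\<iota> (inf x y) = inf (\<iota> x) (\<iota> y)"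
    "\<iota> x \<le> \<iota> y \<longleftrightarrow> x \<le> y" "\<iota> (trunc x y) = trunc (\<iota> x) (\<iota> y)"
proof -
  show basic: "\<iota> 0 = 0" "\<iota> (x + y) = \<iota> x + \<iota> y" "\<iota> (x - y) = \<iota> x - \<iota> y" "\<And>x. \<iota> (- x) = - \<iota> x"
    "\<And>x y. \<iota> (sup x y) = sup (\<iota> x) (\<iota> y)" "\<And>x y. \<iota> (inf x y) = inf (\<iota> x) (\<iota> y)"
    using assms unfolding lattice_embedding_def
    by (auto simp: linear_0 linear_add linear_diff linear_neg)
  show "\<iota> x \<le> \<iota> y \<longleftrightarrow> x \<le> y"
    using assms unfolding lattice_embedding_def le_iff_inf by (metis injD)
  show "\<iota> (trunc x y) = trunc (\<iota> x) (\<iota> y)"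
    by (simp add: trunc_def basic)
qed

lemma adherences_coincide_aux:
  fixes \<iota> :: "'f::normed_lattice \<Rightarrow> 'g::vector_lattice"
  assumes emb: "lattice_embedding \<iota>"
    and approx: "\<And>g. 0 \<le> g \<Longrightarrow> isLub UNIV (\<iota> ` {h. 0 \<le> h \<and> \<iota> h \<le> g}) g"
  shows "order_adherence (\<iota> ` cball 0 1) = uo_adherence (\<iota> ` cball 0 1)"
proof
  show "order_adherence (\<iota> ` cball 0 1) \<subseteq> uo_adherence (\<iota> ` cball 0 1)"
    unfolding order_adherence_def uo_adherence_def
    using order_converges_imp_uo_converges by blast
next
  note simps = lattice_embedding_simps[OF emb]
  show "uo_adherence (\<iota> ` cball 0 1) \<subseteq> order_adherence (\<iota> ` cball 0 1)"
  proof
    fix f assume "f \<in> uo_adherence (\<iota> ` cball 0 1)"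
    then obtain I :: "('g \<times> 'g set) set" and le x where I: "net_index I le"
      and x: "x ` I \<subseteq> \<iota> ` cball 0 1" and uo: "uo_converges I le x f"
      unfolding uo_adherence_def by blast
    obtain Q where Q: "Q \<down> 0"
      and ev: "\<And>q. q \<in> Q \<Longrightarrow> \<exists>i\<in>I. \<forall>j\<in>I. le i j \<longrightarrow> \<bar>inf (\<bar>x j - f\<bar>) (\<bar>f\<bar> + \<bar>f\<bar>) - 0\<bar> \<le> q"
      using uo unfolding uo_converges_def order_converges_def
      by (metis abs_ge_zero add_nonneg_nonneg)
    define H where "H = {h. 0 \<le> h \<and> \<iota> h \<le> \<bar>f\<bar>}"
    have lub: "isLub UNIV (\<iota> ` H) \<bar>f\<bar>" unfolding H_def by (rule approx) simp
    have H0: "0 \<in> H" by (simp add: H_def simps)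
    have Hsup: "sup h k \<in> H" if "h \<in> H" "k \<in> H" for h k
      using that by (auto simp: H_def simps intro: le_supI1)
    define J where "J = I \<times> H"
    define le' where "le' = (\<lambda>(i, h) (j, k). le i j \<and> h \<le> (k::'f))"
    define y where "y = (\<lambda>(i, h). trunc (\<iota> h) (x i))"
    have Ir: "reflp_on I le" and It: "transp_on I le" and Ine: "I \<noteq> {}"
      and Id: "\<And>i j. i \<in> I \<Longrightarrow> j \<in> I \<Longrightarrow> \<exists>k\<in>I. le i k \<and> le j k"
      using I by (auto simp: net_index_def)
    have "net_index J le'"
      unfolding net_index_def
    proof (intro conjI ballI)
      show "J \<noteq> {}" using Ine H0 by (auto simp: J_def)
      show "reflp_on J le'" using Ir by (auto simp: J_def le'_def intro!: reflp_onI dest: reflp_onD)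
      show "transp_on J le'"
      proof (rule transp_onI)
        fix p q r assume "p \<in> J" "q \<in> J" "r \<in> J" "le' p q" "le' q r"
        then show "le' p r"
          using transp_onD[OF It, of "fst p" "fst q" "fst r"]
          by (cases p, cases q, cases r) (auto simp: J_def le'_def intro: order_trans)
      qed
      fix p q assume "p \<in> J" "q \<in> J"
      then obtain i h j k where ij: "p = (i, h)" "q = (j, k)" "i \<in> I" "j \<in> I" "h \<in> H" "k \<in> H"
        by (auto simp: J_def)
      then obtain l where "l \<in> I" "le i l" "le j l" using Id by blast
      then show "\<exists>r\<in>J. le' p r \<and> le' q r"
        using ij Hsup by (intro bexI[of _ "(l, sup h k)"]) (auto simp: J_def le'_def)
    qed
    moreover have "y ` J \<subseteq> \<iota> ` cball 0 1"
    proof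
      fix z assume "z \<in> y ` J"
      then obtain i h where ih: "i \<in> I" "h \<in> H" "z = trunc (\<iota> h) (x i)"
        by (auto simp: J_def y_def)
      then obtain a where a: "a \<in> cball 0 1" "x i = \<iota> a" using x by blast
      have "norm (trunc h a) \<le> norm a"
        using ih by (intro norm_solid abs_trunc_le) (auto simp: H_def)
      then show "z \<in> \<iota> ` cball 0 1"
        using ih a by (intro image_eqI[of _ _ "trunc h a"]) (auto simp: simps)
    qed
    moreover have "order_converges J le' y f"
      unfolding order_converges_def
    proof (intro exI conjI ballI)
      let ?Q = "{q + (\<bar>f\<bar> - \<iota> h) | q h. q \<in> Q \<and> h \<in> H}"
      have Qd: "Q \<noteq> {}" "\<And>p q. p \<in> Q \<Longrightarrow> q \<in> Q \<Longrightarrow> \<exists>r\<in>Q. r \<le> p \<and> r \<le> q"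
        and Q0: "\<And>q. q \<in> Q \<Longrightarrow> 0 \<le> q" and Qg: "\<And>z. (\<And>q. q \<in> Q \<Longrightarrow> z \<le> q) \<Longrightarrow> z \<le> 0"
        using Q by (auto simp: down_to_def downward_directed_def isGlb_UNIV_iff)
      show "?Q \<down> 0"
        unfolding down_to_def downward_directed_def isGlb_UNIV_iff
      proof (intro conjI ballI allI impI)
        show "?Q \<noteq> {}" using Qd(1) H0 by blast
        fix p assume "p \<in> ?Q"
        then obtain q h where p: "p = q + (\<bar>f\<bar> - \<iota> h)" "q \<in> Q" "h \<in> H" by blast
        then show "0 \<le> p" using Q0 by (auto simp: H_def)
        fix p' assume "p' \<in> ?Q"
        then obtain q' h' where p': "p' = q' + (\<bar>f\<bar> - \<iota> h')" "q' \<in> Q" "h' \<in> H" by blast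
        obtain r where r: "r \<in> Q" "r \<le> q" "r \<le> q'" using Qd(2) p p' by blast
        have "r + (\<bar>f\<bar> - \<iota> (sup h h')) \<le> p" "r + (\<bar>f\<bar> - \<iota> (sup h h')) \<le> p'"
          unfolding p p' using r by (intro add_mono diff_left_mono; simp add: simps)+
        then show "\<exists>z\<in>?Q. z \<le> p \<and> z \<le> p'" using r Hsup[OF p(3) p'(3)] by blast
      next
        fix z assume z: "\<forall>p\<in>?Q. z \<le> p"
        show "z \<le> 0"
        proof (rule Qg)
          fix q assume q: "q \<in> Q"
          have "\<iota> h \<le> q + \<bar>f\<bar> - z" if "h \<in> H" for h
          proof -
            have "z \<le> q + (\<bar>f\<bar> - \<iota> h)" using z q that by blast
            then show ?thesis by (simp add: algebra_simps)
          qed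
          then have "\<bar>f\<bar> \<le> q + \<bar>f\<bar> - z" using lub by (auto simp: isLub_UNIV_iff)
          then show "z \<le> q" by (simp add: algebra_simps)
        qed
      qed
      fix p assume "p \<in> ?Q"
      then obtain q h where p: "p = q + (\<bar>f\<bar> - \<iota> h)" "q \<in> Q" "h \<in> H" by blast
      obtain i where i: "i \<in> I"
        "\<And>j. j \<in> I \<Longrightarrow> le i j \<Longrightarrow> \<bar>inf (\<bar>x j - f\<bar>) (\<bar>f\<bar> + \<bar>f\<bar>) - 0\<bar> \<le> q"
        using ev[OF p(2)] by blast
      have "\<bar>y r - f\<bar> \<le> p" if r: "r \<in> J" "le' (i, h) r" for r
      proof -
        obtain j k where jk: "r = (j, k)" "j \<in> I" "k \<in> H" "le i j" "h \<le> k"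
          using r by (auto simp: J_def le'_def)
        let ?k = "\<iota> k"
        have k: "0 \<le> ?k" "?k \<le> \<bar>f\<bar>" using jk(3) simps(7)[of 0 k] by (auto simp: H_def simps(1))
        have "trunc ?k (x j) - trunc ?k f \<le> ?k + ?k" "trunc ?k f - trunc ?k (x j) \<le> ?k + ?k"
          using add_mono[OF trunc_le(1)[OF k(1), of "x j"]] add_mono[OF trunc_le(1)[OF k(1), of f]]
            trunc_le(2)[of ?k f] trunc_le(2)[of ?k "x j"]
          by (metis diff_conv_add_uminus minus_le_iff)+
        then have "\<bar>trunc ?k (x j) - trunc ?k f\<bar> \<le> ?k + ?k" by (intro abs_leI) simp_all
        also have "\<dots> \<le> \<bar>f\<bar> + \<bar>f\<bar>" using k by (intro add_mono)
        finally have "\<bar>trunc ?k (x j) - trunc ?k f\<bar> \<le> inf (\<bar>x j - f\<bar>) (\<bar>f\<bar> + \<bar>f\<bar>)"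
          using abs_trunc_diff_le by (intro le_infI)
        also have "\<dots> \<le> q"
          using i(2)[OF jk(2,4)] abs_ge_self order_trans by (metis diff_zero)
        finally have 1: "\<bar>trunc ?k (x j) - trunc ?k f\<bar> \<le> q" .
        have 2: "\<bar>trunc ?k f - f\<bar> \<le> \<bar>f\<bar> - \<iota> h"
          using abs_trunc_self_diff_le[OF k(2)] jk(5)
          by (meson diff_left_mono order_trans simps(7))
        have "y r - f = (trunc ?k (x j) - trunc ?k f) + (trunc ?k f - f)"
          by (simp add: y_def jk)
        then have "\<bar>y r - f\<bar> \<le> \<bar>trunc ?k (x j) - trunc ?k f\<bar> + \<bar>trunc ?k f - f\<bar>"
          by (metis abs_triangle_ineq)
        also have "\<dots> \<le> p" unfolding p using 1 2 by (rule add_mono)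
        finally show ?thesis .
      qed
      then show "\<exists>i\<in>J. \<forall>j\<in>J. le' i j \<longrightarrow> \<bar>y j - f\<bar> \<le> p"
        using i(1) p(3) by (intro bexI[of _ "(i, h)"]) (auto simp: J_def)
    qed
    ultimately show "f \<in> order_adherence (\<iota> ` cball 0 1)" by (rule order_adherenceI)
  qed
qed

lemma order_adherence_cball_eq_uo_adherence:
  "order_adherence (cball 0 1 :: 'f::normed_lattice set) = uo_adherence (cball 0 1)"
proof -
  have "order_adherence (id ` cball 0 1 :: 'f set) = uo_adherence (id ` cball 0 1)"
    by (rule adherences_coincide_aux)
      (auto simp: lattice_embedding_def isLub_UNIV_iff linear_id)
  then show ?thesis by simp
qed

lemma universally_complete_archimedean:
  fixes e g :: "'g::universally_complete_vector_lattice"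
  assumes "\<And>n::nat. real n *\<^sub>R e \<le> g"
  shows "e \<le> 0"
proof -
  let ?A = "range (\<lambda>n::nat. real n *\<^sub>R e)"
  have "bdd_above ?A" using assms by (intro bdd_aboveI[of _ g]) auto
  then obtain s where s: "\<And>n::nat. real n *\<^sub>R e \<le> s"
      "\<And>z. (\<And>n::nat. real n *\<^sub>R e \<le> z) \<Longrightarrow> s \<le> z"
    using dedekind_complete[of ?A] by auto
  have "s \<le> s - e"
  proof (rule s(2))
    fix n :: nat
    show "real n *\<^sub>R e \<le> s - e" using s(1)[of "Suc n"] by (simp add: algebra_simps)
  qed
  then show ?thesis by simp
qed

lemma order_dense_isLub:
  fixes \<iota> :: "'f::vector_lattice \<Rightarrow> 'g::universally_complete_vector_lattice"
  assumes \<iota>: "universal_completion \<iota>" and g: "0 \<le> g"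
  shows "isLub UNIV (\<iota> ` {h. 0 \<le> h \<and> \<iota> h \<le> g}) g"
  unfolding isLub_UNIV_iff
proof (intro conjI ballI allI impI)
  note simps = lattice_embedding_simps[of \<iota>]
  have emb: "lattice_embedding \<iota>" and dense: "order_dense (range \<iota>)"
    using \<iota> by (auto simp: universal_completion_def)
  show "q \<le> g" if "q \<in> \<iota> ` {h. 0 \<le> h \<and> \<iota> h \<le> g}" for q using that by auto
  fix u assume u: "\<forall>q\<in>\<iota> ` {h. 0 \<le> h \<and> \<iota> h \<le> g}. q \<le> u"
  show "g \<le> u"
  proof (rule ccontr)
    assume "\<not> g \<le> u"
    then have "0 < g - inf g u"
      by (metis diff_ge_0_iff_ge eq_iff_diff_eq_0 inf.cobounded1 le_iff_inf order_le_less)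
    then obtain e where e: "0 < \<iota> e" "\<iota> e \<le> g - inf g u"
      using dense unfolding order_dense_def by blast
    have e0: "0 \<le> e" using order_less_imp_le[OF e(1)] simps(7)[OF emb, of 0 e] simps(1)[OF emb] by simp
    have *: "real n *\<^sub>R \<iota> e \<le> g \<and> 0 \<le> real n *\<^sub>R e" for n :: nat
    proof (induction n)
      case 0
      then show ?case using g by simp
    next
      case (Suc n)
      have lin: "\<iota> (real n *\<^sub>R e) = real n *\<^sub>R \<iota> e"
        using emb by (simp add: lattice_embedding_def linear_scale)
      have "\<iota> (real n *\<^sub>R e) \<in> \<iota> ` {h. 0 \<le> h \<and> \<iota> h \<le> g}"
        using Suc by (intro imageI CollectI) (simp only: lin)
      then have "\<iota> (real n *\<^sub>R e) \<le> u" using u by blast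
      then have "real n *\<^sub>R \<iota> e \<le> inf g u" using Suc lin by simp
      then have "real n *\<^sub>R \<iota> e + \<iota> e \<le> inf g u + (g - inf g u)" using e(2) by (rule add_mono)
      also have "inf g u + (g - inf g u) = g" by (metis add.commute diff_add_cancel)
      finally show ?case using Suc e0 by (simp add: scaleR_add_left add.commute)
    qed
    then have "\<iota> e \<le> 0" by (intro universally_complete_archimedean[of _ g]) simp
    then show False using e(1) by simp
  qed
qed

lemma order_adherence_image_cball_eq_uo_adherence:
  fixes \<iota> :: "'f::normed_lattice \<Rightarrow> 'g::universally_complete_vector_lattice"
  assumes "universal_completion \<iota>"
  shows "order_adherence (\<iota> ` cball 0 1) = uo_adherence (\<iota> ` cball 0 1)"
  using assms order_dense_isLub[OF assms]
  by (intro adherences_coincide_aux) (auto simp: universal_completion_def)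

end

theory Submission
  imports Defs
begin

text \<open>Each condition fails iff some \<open>e > 0\<close> in \<open>F\<close> has all its multiples \<open>n e\<close> among the suprema of
  directed subsets of \<open>B\<^sub>F \<inter> F\<^sub>+\<close>. For the adherences: if a net \<open>x\<close> in the ball converges to
  \<open>f\<close> with error set \<open>Q \<down> 0\<close>, then \<open>(\<bar>f\<bar> - q)\<^sup>+ \<le> \<bar>x\<bar>\<close> eventually, so the elements below some
  \<open>(\<bar>f\<bar> - q)\<^sup>+\<close> lie in the ball and increase to \<open>\<bar>f\<bar>\<close>; truncating by a small element of \<open>F\<close> passes
  from \<open>F\<^sup>u\<close> to \<open>F\<close>. For domination: if \<open>P\<close> is not bounded in \<open>F\<^sup>u\<close>, then some \<open>e > 0\<close> satisfies
  \<open>n e = sup (P \<sqinter> n e)\<close> for all \<open>n\<close>, since otherwise every band contains a vector dominating \<open>P\<close> on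
  its own band, and a maximal disjoint family of such vectors has an upper bound, which bounds
  \<open>P\<close>.\<close>

section \<open>Suprema in vector lattices\<close>

text \<open>Infinite distributivity comes from \<open>a + c = inf a c + sup a c\<close>, which turns
  an upper bound \<open>z\<close> of the truncations into the upper bound
  \<open>z - c + sup s c\<close> of \<open>A\<close>.\<close>

lemma isLub_inf_right:
  fixes s c :: "'a::vector_lattice"
  assumes "isLub UNIV A s"
  shows "isLub UNIV ((\<lambda>x. inf x c) ` A) (inf s c)"
  unfolding isLub_UNIV_iff
proof (intro conjI ballI allI impI)
  have up: "\<And>a. a \<in> A \<Longrightarrow> a \<le> s" and least: "\<And>z. (\<And>a. a \<in> A \<Longrightarrow> a \<le> z) \<Longrightarrow> s \<le> z"
    using assms by (auto simp: isLub_UNIV_iff)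
  show "q \<le> inf s c" if "q \<in> (\<lambda>x. inf x c) ` A" for q
    using that up by (auto intro: le_infI1)
  fix z assume z: "\<forall>q\<in>(\<lambda>x. inf x c) ` A. q \<le> z"
  have "s \<le> z - c + sup s c"
  proof (rule least)
    fix a assume a: "a \<in> A"
    have "a + c = inf a c + sup a c" by (subst add_eq_inf_sup) (rule add.commute)
    also have "\<dots> \<le> z + sup s c" using z a up by (intro add_mono sup_mono) auto
    finally show "a \<le> z - c + sup s c" by (simp add: algebra_simps)
  qed
  then have "s + c \<le> sup s c + z" by (simp add: algebra_simps)
  then show "inf s c \<le> z" by (simp only: add_eq_inf_sup[of s c] add_le_cancel_left)
qed

lemma vector_lattice_inf_sup_distrib:
  fixes a b c :: "'a::vector_lattice"
  shows "inf (sup a b) c = sup (inf a c) (inf b c)"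
proof -
  have "isLub UNIV {a, b} (sup a b)" by (auto simp: isLub_UNIV_iff)
  from isLub_inf_right[OF this, of c] show ?thesis
    by (intro order.antisym) (auto simp: isLub_UNIV_iff le_infI1)
qed

lemma scaleR_le_iff:
  fixes x y :: "'a::ordered_real_vector"
  assumes "0 < r"
  shows "r *\<^sub>R x \<le> y \<longleftrightarrow> x \<le> y /\<^sub>R r"
proof
  assume "r *\<^sub>R x \<le> y"
  then show "x \<le> y /\<^sub>R r"
    using scaleR_left_mono[of "r *\<^sub>R x" y "inverse r"] assms by simp
next
  assume "x \<le> y /\<^sub>R r"
  then show "r *\<^sub>R x \<le> y"
    using scaleR_left_mono[of x "y /\<^sub>R r" r] assms by simp
qed

lemma up_to_scaleR:
  fixes f :: "'a::vector_lattice"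
  assumes "P \<up> f" "0 < r"
  shows "(\<lambda>x. r *\<^sub>R x) ` P \<up> r *\<^sub>R f"
  unfolding up_to_def upward_directed_def isLub_UNIV_iff
proof (intro conjI ballI allI impI)
  let ?P = "(\<lambda>x. r *\<^sub>R x) ` P"
  show "?P \<noteq> {}" using assms by (auto simp: up_to_def upward_directed_def)
  fix x assume x: "x \<in> ?P"
  then show "x \<le> r *\<^sub>R f"
    using assms by (auto simp: up_to_def isLub_UNIV_iff intro!: scaleR_left_mono)
  fix y assume "y \<in> ?P"
  with x obtain a b where ab: "x = r *\<^sub>R a" "y = r *\<^sub>R b" "a \<in> P" "b \<in> P" by blast
  then obtain c where "c \<in> P" "a \<le> c" "b \<le> c"
    using assms by (meson up_to_def upward_directed_def)
  then show "\<exists>z\<in>?P. x \<le> z \<and> y \<le> z"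
    using ab assms by (intro bexI[of _ "r *\<^sub>R c"]) (auto intro!: scaleR_left_mono)
next
  fix z assume "\<forall>q\<in>(\<lambda>x. r *\<^sub>R x) ` P. q \<le> z"
  then show "r *\<^sub>R f \<le> z"
    using assms by (auto simp: up_to_def isLub_UNIV_iff scaleR_le_iff)
qed

lemma upward_directed_image:
  assumes "upward_directed P" "mono f"
  shows "upward_directed (f ` P)"
  using assms unfolding upward_directed_def mono_def by simp meson

section \<open>Disjointness\<close>

text \<open>The right-hand side is the infimum of the four sums \<open>x + y\<close>,
  \<open>x + z\<close>, \<open>z + y\<close>, \<open>z + z\<close>, and the left-hand side lies
  below each of them.\<close>

lemma inf_add_le:
  fixes x y z :: "'a::vector_lattice"
  assumes "0 \<le> x" "0 \<le> y" "0 \<le> z"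
  shows "inf (x + y) z \<le> inf x z + inf y z"
proof -
  have "inf (x + y) z \<le> z + y" "inf (x + y) z \<le> x + z" "inf (x + y) z \<le> z + z"
    using assms by (auto intro!: le_infI2 simp: add_increasing add_increasing2)
  then show ?thesis
    by (simp add: add_inf_distrib_left add_inf_distrib_right)
qed

lemma disjoint_add:
  fixes x y z :: "'a::vector_lattice"
  assumes "0 \<le> x" "0 \<le> y" "0 \<le> z" "inf x z = 0" "inf y z = 0"
  shows "inf (x + y) z = 0"
  using inf_add_le[of x y z] assms by (intro order.antisym) (auto intro: add_nonneg_nonneg)

lemma disjoint_scaleR_nat:
  fixes x z :: "'a::vector_lattice"
  assumes "0 \<le> x" "0 \<le> z" "inf x z = 0"
  shows "inf (real n *\<^sub>R x) z = 0"
proof (induction n)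
  case 0
  then show ?case using assms by (simp add: inf_absorb1)
next
  case (Suc n)
  then show ?case
    using disjoint_add[of x "real n *\<^sub>R x" z] assms
    by (simp add: scaleR_add_left scaleR_nonneg_nonneg)
qed

lemma disjoint_mono:
  fixes x y z :: "'a::vector_lattice"
  assumes "0 \<le> x" "x \<le> y" "0 \<le> z" "inf y z = 0"
  shows "inf x z = 0"
  using assms by (intro order.antisym) (auto intro: order_trans[OF inf_mono[OF assms(2) order_refl]])

text \<open>Writing the negative part as \<open>sup x 0 - x\<close> and pulling out
  \<open>sup x 0\<close> leaves \<open>inf 0 (- x)\<close>, which is
  \<open>- sup x 0\<close>.\<close>

lemma disjoint_pos_neg_parts:
  fixes x :: "'a::vector_lattice"
  shows "inf (sup x 0) (sup (- x) 0) = 0"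
proof -
  have "sup (- x) 0 = sup x 0 + (- x)"
    by (simp only: add_sup_distrib_right right_minus add_0 sup_commute)
  then have "inf (sup x 0) (sup (- x) 0) = sup x 0 + inf 0 (- x)"
    by (simp only: add_inf_distrib_left add_0_right)
  also have "inf 0 (- x) = - sup x 0" by (subst neg_sup_eq_inf) (simp add: inf_commute)
  also have "sup x 0 + - sup x 0 = 0" by (rule right_minus)
  finally show ?thesis .
qed

text \<open>The second hypothesis expresses, without a band projection, that \<open>p\<close> stays
  below \<open>d\<close> on the band of \<open>d\<close>: translated by \<open>- d\<close> it reads
  \<open>inf (p - d) d \<le> 0\<close>.\<close>

lemma disjoint_sup_diff:
  fixes p d :: "'a::vector_lattice"
  assumes "0 \<le> d" "inf p (2 *\<^sub>R d) \<le> d"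
  shows "inf (sup (p - d) 0) d = 0"
proof -
  have "inf (p - d) d + d = inf p (2 *\<^sub>R d)"
    by (simp add: add_inf_distrib_right scaleR_2)
  then have "inf (p - d) d \<le> 0"
    using assms(2) add_le_cancel_right[of "inf (p - d) d" d 0] by simp
  then show ?thesis
    using assms(1) by (simp only: vector_lattice_inf_sup_distrib inf_absorb1 sup_absorb2)
qed

section \<open>Unbounded sets in universally complete vector lattices\<close>

text \<open>The witness is the component of \<open>a\<close> in the band generated by \<open>w\<close>; the band is avoided by
  writing the witness as \<open>\<Squnion>k. a \<sqinter> k w\<close>.\<close>

lemma exists_band_component:
  fixes a w :: "'u::universally_complete_vector_lattice"
  assumes w: "0 \<le> w" "w \<le> a"
  obtains c where "w \<le> c" "c \<le> a" "inf (a - c) c = 0"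
    "\<And>z. 0 \<le> z \<Longrightarrow> inf z w = 0 \<Longrightarrow> inf z c = 0"
proof -
  have a: "0 \<le> a" using w by simp
  let ?A = "range (\<lambda>k::nat. inf (real k *\<^sub>R w) a)"
  have "bdd_above ?A" by (intro bdd_aboveI[of _ a]) auto
  then obtain c where c: "\<And>k::nat. inf (real k *\<^sub>R w) a \<le> c"
      "\<And>z. (\<And>k::nat. inf (real k *\<^sub>R w) a \<le> z) \<Longrightarrow> c \<le> z"
    using dedekind_complete[of ?A] by auto
  have wc: "w \<le> c" using c(1)[of 1] w by (simp add: inf_absorb1)
  have ca: "c \<le> a" by (rule c(2)) simp
  have lub: "isLub UNIV ?A c" using c by (auto simp: isLub_UNIV_iff)
  have disj: "inf z c = 0" if z: "0 \<le> z" "inf z w = 0" for z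
  proof -
    have "inf (inf (real k *\<^sub>R w) a) z = 0" for k
      using disjoint_mono[of "inf (real k *\<^sub>R w) a" "real k *\<^sub>R w" z] disjoint_scaleR_nat[of w z k]
        z w a by (simp add: inf_commute scaleR_nonneg_nonneg)
    \<comment> \<open>Infinite distributivity carries disjointness from the truncations to their
      supremum \<open>c\<close>.\<close>
    then have "inf c z \<le> 0"
      using isLub_inf_right[OF lub, of z] by (auto simp: isLub_UNIV_iff)
    then show ?thesis using z w wc by (auto simp: inf_commute intro: order.antisym)
  qed
  define v where "v = inf (a - c) w"
  \<comment> \<open>Adding \<open>v\<close> to the truncation at \<open>k\<close> stays below the
    truncation at \<open>k + 1\<close>. So \<open>c - v\<close> bounds all truncations too and
    \<open>v\<close> vanishes; then \<open>a - c\<close> is disjoint from \<open>w\<close>, hence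
    from \<open>c\<close>.\<close>
  have "c \<le> c - v"
  proof (rule c(2))
    fix k :: nat
    have "inf (real k *\<^sub>R w) a + v \<le> real k *\<^sub>R w + w"
      by (intro add_mono) (simp_all add: v_def)
    moreover have "inf (real k *\<^sub>R w) a + v \<le> c + (a - c)"
      by (intro add_mono c(1)) (simp add: v_def)
    ultimately have "inf (real k *\<^sub>R w) a + v \<le> inf (real (Suc k) *\<^sub>R w) a"
      by (simp add: scaleR_add_left add.commute)
    also have "\<dots> \<le> c" by (rule c(1))
    finally show "inf (real k *\<^sub>R w) a \<le> c - v" by (simp add: algebra_simps)
  qed
  then have "v \<le> 0" by simp
  moreover have "0 \<le> v" using w ca by (simp add: v_def)
  ultimately have "v = 0" by (rule order.antisym)
  then have "inf (a - c) c = 0" using disj[of "a - c"] ca by (simp add: v_def)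
  then show thesis by (rule that[OF wc ca]) (rule disj)
qed

lemma exists_unbounded_direction:
  fixes P :: "'u::universally_complete_vector_lattice set"
  assumes P0: "\<And>p. p \<in> P \<Longrightarrow> 0 \<le> p" and unbdd: "\<not> bdd_above P"
  shows "\<exists>e>0. \<forall>n::nat. isLub UNIV ((\<lambda>p. inf p (real n *\<^sub>R e)) ` P) (real n *\<^sub>R e)"
proof (rule ccontr)
  assume *: "\<not> ?thesis"
  then have bounded: "\<exists>n::nat. \<not> isLub UNIV ((\<lambda>p. inf p (real n *\<^sub>R e)) ` P) (real n *\<^sub>R e)"
    if "0 < e" for e using that * by blast
  obtain p0 where p0: "p0 \<in> P" using unbdd by fastforce
  \<comment> \<open>These vectors dominate \<open>P\<close> on the band that they generate, in the
    form required by \<open>disjoint_sup_diff\<close>.\<close>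
  define C where "C = {c. 0 < c \<and> (\<forall>p\<in>P. inf p (2 *\<^sub>R c) \<le> c)}"
  \<comment> \<open>The disjointness clause places \<open>c\<close> in the band of \<open>e\<close>;
    the maximality argument below needs \<open>c\<close> to inherit the disjointness of
    \<open>e\<close> from a family.\<close>
  have local: "\<exists>c\<in>C. \<forall>d\<ge>0. inf e d = 0 \<longrightarrow> inf c d = 0" if e: "0 < e" for e
  proof -
    obtain n :: nat where n: "\<not> isLub UNIV ((\<lambda>p. inf p (real n *\<^sub>R e)) ` P) (real n *\<^sub>R e)"
      using bounded[OF e] by blast
    define a where "a = real n *\<^sub>R e"
    have a0: "0 \<le> a" using e by (simp add: a_def scaleR_nonneg_nonneg)
    obtain u where u: "\<And>p. p \<in> P \<Longrightarrow> inf p a \<le> u" "\<not> a \<le> u"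
      using n unfolding isLub_UNIV_iff a_def[symmetric] by auto
    \<comment> \<open>This is the positive part of \<open>a - u\<close>. It is nonzero because
      \<open>u\<close> bounds the truncations but not \<open>a\<close>, and on its band every
      element of \<open>P\<close> stays below \<open>a\<close>.\<close>
    define w where "w = a - inf a u"
    have "0 \<le> u" using u(1)[OF p0] P0[OF p0] a0 by (meson le_infI order_trans)
    then have wa: "w \<le> a" using a0 by (simp add: w_def)
    have "inf a u < a" using u(2) by (simp add: less_le inf.absorb_iff1[symmetric])
    then have w0: "0 < w" unfolding w_def by (simp only: diff_gt_0_iff_gt)
    obtain c where c: "w \<le> c" "c \<le> a" "inf (a - c) c = 0"
      "\<And>z. 0 \<le> z \<Longrightarrow> inf z w = 0 \<Longrightarrow> inf z c = 0"
      by (rule exists_band_component[OF less_imp_le[OF w0] wa]) (rule that)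
    have c0: "0 < c" using w0 c(1) by simp
    have "inf p (2 *\<^sub>R c) \<le> c" if p: "p \<in> P" for p
    proof -
      let ?x = "sup (p - a) 0"
      \<comment> \<open>Since \<open>w\<close> lies below the positive part of \<open>a - p\<close>,
        it is disjoint from the excess of \<open>p\<close> over \<open>a\<close>; by the choice of
        \<open>c\<close>, so is \<open>c\<close>.\<close>
      have "w \<le> a - inf p a" unfolding w_def using u(1)[OF p] by (intro diff_left_mono) simp
      also have "a - inf p a = sup (a - p) 0"
        by (simp only: diff_inf_eq_sup add_sup_distrib_left right_minus sup_commute flip: diff_conv_add_uminus)
      finally have "inf ?x w \<le> inf ?x (sup (a - p) 0)" by (intro inf_mono) auto
      also have "\<dots> = 0" using disjoint_pos_neg_parts[of "p - a"] by simp
      finally have "inf ?x w = 0" using w0 by (intro order.antisym) auto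
      then have "inf ?x c = 0" by (intro c(4)) auto
      \<comment> \<open>The difference \<open>p - c\<close> splits into \<open>p - a\<close> and
        \<open>a - c\<close>; hence it lies below a sum of two vectors disjoint from
        \<open>c\<close>.\<close>
      then have "inf (?x + (a - c)) c = 0"
        using c c0 by (intro disjoint_add) auto
      moreover have "p - c \<le> ?x + (a - c)"
        using add_right_mono[of "p - a" ?x "a - c"] by simp
      ultimately have "inf (p - c) c \<le> 0"
        by (metis inf_mono order_refl)
      then have "inf (p - c) c + c \<le> 0 + c" by (rule add_right_mono)
      then show ?thesis by (simp add: add_inf_distrib_right scaleR_2)
    qed
    then have "c \<in> C" using c0 by (simp add: C_def)
    moreover have "inf c d = 0" if "0 \<le> d" "inf e d = 0" for d
      using disjoint_mono[OF _ c(2) that(1)] disjoint_scaleR_nat[of e d n] that e c0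
      by (simp add: a_def)
    ultimately show ?thesis by blast
  qed
  let ?F = "{D. D \<subseteq> C \<and> pairwise (\<lambda>c d. inf c d = 0) D}"
  have "\<exists>M\<in>?F. \<forall>X\<in>?F. M \<subseteq> X \<longrightarrow> X = M"
  proof (rule subset_Zorn')
    fix \<C> assume ch: "subset.chain ?F \<C>"
    have "pairwise (\<lambda>c d. inf c d = 0) (\<Union>\<C>)"
    proof (rule pairwiseI)
      fix x y assume xy: "x \<in> \<Union>\<C>" "y \<in> \<Union>\<C>" "x \<noteq> y"
      then obtain X Y where "x \<in> X" "y \<in> Y" "X \<in> \<C>" "Y \<in> \<C>" by blast
      moreover from this have "X \<subseteq> Y \<or> Y \<subseteq> X" using ch by (simp add: subset_chain_def)
      ultimately obtain Z where Z: "Z \<in> \<C>" "x \<in> Z" "y \<in> Z" by blast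
      have "\<C> \<subseteq> ?F" using ch by (simp add: subset_chain_def)
      then have "pairwise (\<lambda>c d. inf c d = 0) Z" using Z(1) by blast
      then show "inf x y = 0" using Z(2,3) xy(3) by (rule pairwiseD)
    qed
    moreover have "\<C> \<subseteq> ?F" using ch by (simp add: subset_chain_def)
    then have "\<Union>\<C> \<subseteq> C" by blast
    ultimately show "\<Union>\<C> \<in> ?F" by simp
  qed
  then obtain D where D: "D \<in> ?F" and Dmax: "\<forall>X\<in>?F. D \<subseteq> X \<longrightarrow> X = D"
    by (rule bexE)
  have D0: "0 \<le> d" if "d \<in> D" for d using D that by (auto simp: C_def less_imp_le)
  then have "bdd_above D" using D by (intro disjoint_bdd_above) auto
  then obtain h where h: "\<And>d. d \<in> D \<Longrightarrow> d \<le> h" by (auto simp: bdd_above_def)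
  have "p \<le> h" if p: "p \<in> P" for p
  proof (rule ccontr)
    assume "\<not> p \<le> h"
    \<comment> \<open>The excess of \<open>p\<close> over \<open>h\<close> lies below its excess
      over each \<open>d \<in> D\<close>, which is disjoint from \<open>d\<close> because
      \<open>d\<close> dominates \<open>P\<close> on its own band.\<close>
    define e where "e = sup (p - h) 0"
    have "\<not> e \<le> 0" using \<open>\<not> p \<le> h\<close> by (simp add: e_def)
    moreover have "0 \<le> e" by (simp add: e_def)
    ultimately have e: "0 < e" by (simp add: less_le_not_le)
    have disj: "inf e d = 0" if d: "d \<in> D" for d
    proof -
      have "e \<le> sup (p - d) 0" unfolding e_def using h[OF d] by (intro sup_mono diff_left_mono order_refl)
      moreover have "inf (sup (p - d) 0) d = 0"
        using D d p by (intro disjoint_sup_diff D0) (auto simp: C_def)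
      ultimately show ?thesis by (rule disjoint_mono[OF less_imp_le[OF e] _ D0[OF d]])
    qed
    obtain c where c: "c \<in> C" "\<forall>d\<ge>0. inf e d = 0 \<longrightarrow> inf c d = 0"
      using local[OF e] by (rule bexE)
    have cD: "inf c d = 0" if "d \<in> D" for d using c(2) D0 disj that by simp
    then have "insert c D \<in> ?F"
      using D c(1) by (simp add: pairwise_insert inf_commute[of _ c])
    \<comment> \<open>Maximality puts \<open>c\<close> into \<open>D\<close>, so \<open>c\<close> is
      disjoint from itself, against \<open>0 < c\<close>.\<close>
    with Dmax have "D \<subseteq> insert c D \<longrightarrow> insert c D = D" by (rule bspec)
    then have "insert c D = D" using subset_insertI by (rule mp)
    then have "c \<in> D" by blast
    then show False using cD[of c] c(1) by (simp add: C_def)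
  qed
  then show False using unbdd by (auto simp: bdd_above_def)
qed

section \<open>Suprema of directed subsets of the unit ball\<close>

text \<open>The suprema are taken in \<open>F\<close>; \<open>embedding_up_to_iff\<close> identifies
  them with those suprema in \<open>F\<^sup>u\<close> that lie in \<open>F\<close>.\<close>

definition ball_sups :: "'f::normed_lattice set" where
  "ball_sups = {f. \<exists>P. P \<subseteq> cball 0 1 \<inter> {0..} \<and> P \<up> f}"

text \<open>The hypothesis \<open>approx\<close> holds for the identity of \<open>F\<close> and for
  the embedding into \<open>F\<^sup>u\<close>, so one argument serves both adherences.\<close>

lemma order_adherence_imp_up_to:
  fixes \<iota> :: "'f::normed_lattice \<Rightarrow> 'g::vector_lattice"
  assumes emb: "lattice_embedding \<iota>"
    and approx: "\<And>g. 0 \<le> g \<Longrightarrow> isLub UNIV (\<iota> ` {h. 0 \<le> h \<and> \<iota> h \<le> g}) g"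
    and f: "f \<in> order_adherence (\<iota> ` cball 0 1)"
  shows "\<exists>P. P \<subseteq> cball 0 1 \<inter> {0..} \<and> \<iota> ` P \<up> \<bar>f\<bar>"
proof -
  note simps = lattice_embedding_simps[OF emb]
  obtain I :: "('g \<times> 'g set) set" and le x where I: "net_index I le"
    and x: "x ` I \<subseteq> \<iota> ` cball 0 1" and conv: "order_converges I le x f"
    using f unfolding order_adherence_def by blast
  obtain Q where Q: "Q \<down> 0"
    and ev: "\<And>q. q \<in> Q \<Longrightarrow> \<exists>i\<in>I. \<forall>j\<in>I. le i j \<longrightarrow> \<bar>x j - f\<bar> \<le> q"
    using conv unfolding order_converges_def by blast
  have Qne: "Q \<noteq> {}" and Qdir: "\<And>p q. p \<in> Q \<Longrightarrow> q \<in> Q \<Longrightarrow> \<exists>r\<in>Q. r \<le> p \<and> r \<le> q"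
    and Q0: "\<And>q. q \<in> Q \<Longrightarrow> 0 \<le> q" and Qglb: "\<And>z. (\<And>q. q \<in> Q \<Longrightarrow> z \<le> q) \<Longrightarrow> z \<le> 0"
    using Q by (auto simp: down_to_def downward_directed_def isGlb_UNIV_iff)
  \<comment> \<open>The vectors \<open>sup (\<bar>f\<bar> - q) 0\<close> need not lie in the range
    of \<open>\<iota>\<close>, so all positive elements of \<open>F\<close> below them are taken. As
    \<open>q\<close> decreases these vectors increase, so \<open>P\<close> is directed.\<close>
  define P where "P = {h. 0 \<le> h \<and> (\<exists>q\<in>Q. \<iota> h \<le> sup (\<bar>f\<bar> - q) 0)}"
  have "P \<subseteq> cball 0 1"
  proof
    fix h assume "h \<in> P"
    then obtain q where q: "0 \<le> h" "q \<in> Q" "\<iota> h \<le> sup (\<bar>f\<bar> - q) 0" by (auto simp: P_def)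
    obtain i where "i \<in> I" "\<bar>x i - f\<bar> \<le> q"
      using ev[OF q(2)] I by (auto simp: net_index_def reflp_on_def)
    moreover obtain a where a: "norm a \<le> 1" "x i = \<iota> a" using x \<open>i \<in> I\<close> by auto
    ultimately have "\<bar>f\<bar> - q \<le> \<bar>\<iota> a\<bar>"
      using abs_triangle_ineq2[of f "x i"]
      by (metis abs_minus_commute diff_le_eq add.commute order_trans)
    then have "sup (\<bar>f\<bar> - q) 0 \<le> \<bar>\<iota> a\<bar>" by (intro le_supI abs_ge_zero)
    with q(3) have "\<iota> h \<le> \<bar>\<iota> a\<bar>" by (rule order_trans)
    also have "\<bar>\<iota> a\<bar> = \<iota> \<bar>a\<bar>" by (simp add: abs_lattice simps)
    finally have "\<bar>h\<bar> \<le> \<bar>a\<bar>" using q(1) by (simp add: simps)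
    then show "h \<in> cball 0 1" using norm_solid a(1) by fastforce
  qed
  moreover have "upward_directed P"
    unfolding upward_directed_def
  proof (intro conjI ballI)
    show "P \<noteq> {}" using Qne by (auto simp: P_def simps intro!: exI[of _ 0])
    fix h k assume "h \<in> P" "k \<in> P"
    then obtain q r where qr: "0 \<le> h" "0 \<le> k" "q \<in> Q" "r \<in> Q"
      "\<iota> h \<le> sup (\<bar>f\<bar> - q) 0" "\<iota> k \<le> sup (\<bar>f\<bar> - r) 0" by (auto simp: P_def)
    obtain s where s: "s \<in> Q" "s \<le> q" "s \<le> r" using Qdir qr by blast
    have "sup (\<bar>f\<bar> - q) 0 \<le> sup (\<bar>f\<bar> - s) 0" "sup (\<bar>f\<bar> - r) 0 \<le> sup (\<bar>f\<bar> - s) 0"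
      using s by (intro sup_mono diff_left_mono order_refl; simp)+
    then have "\<iota> (sup h k) \<le> sup (\<bar>f\<bar> - s) 0" using qr(5,6) unfolding simps by (meson le_supI order_trans)
    then have "sup h k \<in> P" using s qr by (auto simp: P_def intro: le_supI1)
    then show "\<exists>z\<in>P. h \<le> z \<and> k \<le> z" by (intro bexI[of _ "sup h k"]) auto
  qed
  then have "upward_directed (\<iota> ` P)"
    by (rule upward_directed_image) (simp add: mono_def simps)
  moreover have "isLub UNIV (\<iota> ` P) \<bar>f\<bar>"
    unfolding isLub_UNIV_iff
  proof (intro conjI ballI allI impI)
    fix y assume "y \<in> \<iota> ` P"
    then obtain q where q: "q \<in> Q" "y \<le> sup (\<bar>f\<bar> - q) 0" by (auto simp: P_def)
    have "sup (\<bar>f\<bar> - q) 0 \<le> \<bar>f\<bar>" using Q0[OF q(1)] by simp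
    with q(2) show "y \<le> \<bar>f\<bar>" by (rule order_trans)
  next
    fix z assume z: "\<forall>y\<in>\<iota> ` P. y \<le> z"
    \<comment> \<open>By \<open>approx\<close> each \<open>sup (\<bar>f\<bar> - q) 0\<close> is a
      supremum of elements of the image of \<open>P\<close>, hence below \<open>z\<close>. So
      \<open>\<bar>f\<bar> - z\<close> is a lower bound of \<open>Q\<close>.\<close>
    have "\<bar>f\<bar> - z \<le> 0"
    proof (rule Qglb)
      fix q assume q: "q \<in> Q"
      have "sup (\<bar>f\<bar> - q) 0 \<le> z"
        using approx[of "sup (\<bar>f\<bar> - q) 0"] z q by (auto simp: isLub_UNIV_iff P_def)
      then show "\<bar>f\<bar> - z \<le> q" by (simp add: algebra_simps)
    qed
    then show "\<bar>f\<bar> \<le> z" by simp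
  qed
  ultimately show ?thesis
    by (intro exI[of _ P]) (auto simp: P_def up_to_def)
qed

text \<open>The set \<open>P\<close> indexes itself as an increasing net, and the differences
  \<open>f - p\<close> form the error set decreasing to zero.\<close>

lemma up_to_imp_order_adherence:
  fixes P :: "'g::vector_lattice set"
  assumes "P \<subseteq> A" "P \<up> f"
  shows "f \<in> order_adherence A"
proof (rule order_adherenceI[of P "(\<le>)" "\<lambda>p. p"])
  have dir: "P \<noteq> {}" "\<And>x y. x \<in> P \<Longrightarrow> y \<in> P \<Longrightarrow> \<exists>z\<in>P. x \<le> z \<and> y \<le> z"
    and up: "\<And>p. p \<in> P \<Longrightarrow> p \<le> f" and least: "\<And>z. (\<And>p. p \<in> P \<Longrightarrow> p \<le> z) \<Longrightarrow> f \<le> z"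
    using assms by (auto simp: up_to_def upward_directed_def isLub_UNIV_iff)
  show "net_index P (\<le>)"
    using dir by (auto simp: net_index_def reflp_on_def transp_on_def)
  have "(\<lambda>p. f - p) ` P \<down> 0"
    unfolding down_to_def downward_directed_def isGlb_UNIV_iff
  proof (intro conjI ballI allI impI)
    fix x y assume "x \<in> (\<lambda>p. f - p) ` P" "y \<in> (\<lambda>p. f - p) ` P"
    then obtain p q where pq: "x = f - p" "y = f - q" "p \<in> P" "q \<in> P" by blast
    then obtain r where "r \<in> P" "p \<le> r" "q \<le> r" using dir by blast
    then show "\<exists>z\<in>(\<lambda>p. f - p) ` P. z \<le> x \<and> z \<le> y"
      using pq by (intro bexI[of _ "f - r"]) auto
  next
    fix z assume z: "\<forall>q\<in>(\<lambda>p. f - p) ` P. z \<le> q"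
    have "f \<le> f - z"
    proof (rule least)
      fix p assume "p \<in> P"
      then have "z \<le> f - p" using z by blast
      then show "p \<le> f - z" by (simp add: algebra_simps)
    qed
    then show "z \<le> 0" by simp
  qed (use dir up in auto)
  moreover have "\<bar>j - f\<bar> \<le> f - p" if "j \<in> P" "p \<le> j" for p j
    using up[OF that(1)] that(2) by (simp add: abs_minus_commute[of j])
  ultimately show "order_converges P (\<le>) (\<lambda>p. p) f"
    unfolding order_converges_def by (intro exI[of _ "(\<lambda>p. f - p) ` P"]) auto
qed (use assms in simp)

section \<open>Radial boundedness of the order adherence\<close>

lemma order_converges_same_null_set:
  assumes "order_converges I le x f" "\<And>i. i \<in> I \<Longrightarrow> \<bar>y i - g\<bar> \<le> \<bar>x i - f\<bar>"
  shows "order_converges I le y g"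
  using assms unfolding order_converges_def by (meson order_trans)

lemma abs_scaleR_nonneg:
  fixes x :: "'a::vector_lattice"
  assumes "0 \<le> r"
  shows "\<bar>r *\<^sub>R x\<bar> = r *\<^sub>R \<bar>x\<bar>"
proof (cases "r = 0")
  case False
  have le: "\<bar>r *\<^sub>R x\<bar> \<le> r *\<^sub>R \<bar>x\<bar>" if "0 \<le> r" for r and x :: 'a
    using that scaleR_left_mono[OF abs_ge_self[of x]] scaleR_left_mono[OF abs_ge_minus_self[of x]]
    by (intro abs_leI) (simp_all flip: scaleR_minus_right)
  \<comment> \<open>Applying the inequality to the factor \<open>inverse r\<close> and the vector
    \<open>r *\<^sub>R x\<close> gives the reverse inequality.\<close>
  have "\<bar>x\<bar> \<le> \<bar>r *\<^sub>R x\<bar> /\<^sub>R r" using le[of "inverse r" "r *\<^sub>R x"] False assms by simp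
  then have "r *\<^sub>R \<bar>x\<bar> \<le> \<bar>r *\<^sub>R x\<bar>" using False assms by (simp add: scaleR_le_iff)
  then show ?thesis using le[OF assms] by (intro order.antisym)
qed simp

lemma abs_scaleR_le:
  fixes x :: "'a::vector_lattice"
  assumes "\<bar>r\<bar> \<le> 1"
  shows "\<bar>r *\<^sub>R x\<bar> \<le> \<bar>x\<bar>"
proof -
  have "\<bar>r *\<^sub>R x\<bar> = \<bar>\<bar>r\<bar> *\<^sub>R x\<bar>" by (cases "0 \<le> r") simp_all
  also have "\<dots> = \<bar>r\<bar> *\<^sub>R \<bar>x\<bar>" by (simp add: abs_scaleR_nonneg)
  also have "\<dots> \<le> 1 *\<^sub>R \<bar>x\<bar>" using assms by (intro scaleR_right_mono) auto
  finally show ?thesis by simp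
qed

lemma balanced_order_adherence:
  assumes "balanced A"
  shows "balanced (order_adherence A)"
  unfolding balanced_def
proof (intro allI impI subsetI)
  fix r :: real and g assume r: "\<bar>r\<bar> \<le> 1" and "g \<in> (\<lambda>x. r *\<^sub>R x) ` order_adherence A"
  then obtain f where g: "g = r *\<^sub>R f" and f: "f \<in> order_adherence A" by blast
  then obtain I :: "('a \<times> 'a set) set" and le x where I: "net_index I le" "x ` I \<subseteq> A"
    "order_converges I le x f" unfolding order_adherence_def by blast
  show "g \<in> order_adherence A"
  proof (rule order_adherenceI[OF I(1)])
    show "(\<lambda>i. r *\<^sub>R x i) ` I \<subseteq> A" using I(2) assms r by (auto simp: balanced_def)
    show "order_converges I le (\<lambda>i. r *\<^sub>R x i) g"
      using I(3) by (rule order_converges_same_null_set)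
        (use abs_scaleR_le[OF r] in \<open>simp add: g flip: scaleR_diff_right\<close>)
  qed
qed

lemma net_index_Times:
  assumes "net_index I le" "net_index J le'"
  shows "net_index (I \<times> J) (\<lambda>p q. le (fst p) (fst q) \<and> le' (snd p) (snd q))"
  unfolding net_index_def
proof (intro conjI ballI)
  note I = assms(1)[unfolded net_index_def] and J = assms(2)[unfolded net_index_def]
  let ?le = "\<lambda>p q. le (fst p) (fst q) \<and> le' (snd p) (snd q)"
  show "I \<times> J \<noteq> {}" using I J by simp
  show "reflp_on (I \<times> J) ?le" using I J by (auto simp: reflp_on_def)
  show "transp_on (I \<times> J) ?le"
  proof (rule transp_onI)
    fix p q r assume "p \<in> I \<times> J" "q \<in> I \<times> J" "r \<in> I \<times> J" "?le p q" "?le q r"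
    then show "?le p r"
      using I J transp_onD[of I le "fst p" "fst q" "fst r"] transp_onD[of J le' "snd p" "snd q" "snd r"]
      by (simp add: mem_Times_iff)
  qed
  fix p q assume "p \<in> I \<times> J" "q \<in> I \<times> J"
  then obtain k l where "k \<in> I" "le (fst p) k" "le (fst q) k"
    and "l \<in> J" "le' (snd p) l" "le' (snd q) l" using I J by (metis mem_Times_iff)
  then show "\<exists>r\<in>I \<times> J. ?le p r \<and> ?le q r" by (intro bexI[of _ "(k, l)"]) auto
qed

lemma down_to_add:
  fixes P Q :: "'g::vector_lattice set"
  assumes P: "P \<down> 0" and Q: "Q \<down> 0"
  shows "(\<lambda>(p, q). p + q) ` (P \<times> Q) \<down> 0"
  unfolding down_to_def downward_directed_def isGlb_UNIV_iff
proof (intro conjI ballI allI impI)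
  let ?S = "(\<lambda>(p, q). p + q) ` (P \<times> Q)"
  show "?S \<noteq> {}" using P Q by (auto simp: down_to_def downward_directed_def)
  fix x assume "x \<in> ?S"
  then obtain p q where x: "x = p + q" "p \<in> P" "q \<in> Q" by auto
  then show "0 \<le> x" using P Q by (auto simp: down_to_def isGlb_UNIV_iff)
  fix y assume "y \<in> ?S"
  then obtain p' q' where y: "y = p' + q'" "p' \<in> P" "q' \<in> Q" by auto
  obtain p'' where "p'' \<in> P" "p'' \<le> p" "p'' \<le> p'"
    using P x y by (meson down_to_def downward_directed_def)
  moreover obtain q'' where "q'' \<in> Q" "q'' \<le> q" "q'' \<le> q'"
    using Q x y by (meson down_to_def downward_directed_def)
  ultimately show "\<exists>z\<in>?S. z \<le> x \<and> z \<le> y"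
    using x y by (intro bexI[of _ "p'' + q''"]) (auto intro: add_mono)
next
  fix z assume z: "\<forall>x\<in>(\<lambda>(p, q). p + q) ` (P \<times> Q). z \<le> x"
  have "z \<le> p" if p: "p \<in> P" for p
  proof -
    have "z - p \<le> q" if "q \<in> Q" for q using z p that by (auto simp: algebra_simps)
    then have "z - p \<le> 0" using Q unfolding down_to_def isGlb_UNIV_iff by blast
    then show ?thesis by simp
  qed
  then show "z \<le> 0" using P by (auto simp: down_to_def isGlb_UNIV_iff)
qed

text \<open>The combined net runs over the product index set. Both coefficients are at most 1, so
  the sums of the two error sets bound its error.\<close>

lemma convex_order_adherence:
  assumes "convex A"
  shows "convex (order_adherence A)"
proof (rule convexI)
  fix f g :: 'a and u v :: real
  assume uv: "0 \<le> u" "0 \<le> v" "u + v = 1"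
    and f: "f \<in> order_adherence A" and g: "g \<in> order_adherence A"
  obtain I :: "('a \<times> 'a set) set" and le x
    where I: "net_index I le" "x ` I \<subseteq> A" "order_converges I le x f"
    using f unfolding order_adherence_def by blast
  obtain J :: "('a \<times> 'a set) set" and le' y
    where J: "net_index J le'" "y ` J \<subseteq> A" "order_converges J le' y g"
    using g unfolding order_adherence_def by blast
  let ?le = "\<lambda>p q. le (fst p) (fst q) \<and> le' (snd p) (snd q)"
  let ?z = "\<lambda>p. u *\<^sub>R x (fst p) + v *\<^sub>R y (snd p)"
  show "u *\<^sub>R f + v *\<^sub>R g \<in> order_adherence A"
  proof (rule order_adherenceI[OF net_index_Times[OF I(1) J(1)]])
    show "?z ` (I \<times> J) \<subseteq> A" using I(2) J(2) assms uv by (auto intro!: convexD)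
    obtain P where P: "P \<down> 0" "\<And>q. q \<in> P \<Longrightarrow> \<exists>i\<in>I. \<forall>j\<in>I. le i j \<longrightarrow> \<bar>x j - f\<bar> \<le> q"
      using I(3) unfolding order_converges_def by blast
    obtain Q where Q: "Q \<down> 0" "\<And>q. q \<in> Q \<Longrightarrow> \<exists>i\<in>J. \<forall>j\<in>J. le' i j \<longrightarrow> \<bar>y j - g\<bar> \<le> q"
      using J(3) unfolding order_converges_def by blast
    have tail: "\<exists>i\<in>I \<times> J. \<forall>j\<in>I \<times> J. ?le i j \<longrightarrow> \<bar>?z j - (u *\<^sub>R f + v *\<^sub>R g)\<bar> \<le> p + q"
      if pq: "p \<in> P" "q \<in> Q" for p q
    proof -
      obtain i where i: "i \<in> I" "\<And>j. j \<in> I \<Longrightarrow> le i j \<Longrightarrow> \<bar>x j - f\<bar> \<le> p" using P(2) pq by blast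
      obtain k where k: "k \<in> J" "\<And>j. j \<in> J \<Longrightarrow> le' k j \<Longrightarrow> \<bar>y j - g\<bar> \<le> q" using Q(2) pq by blast
      have "\<bar>?z j - (u *\<^sub>R f + v *\<^sub>R g)\<bar> \<le> p + q" if j: "j \<in> I \<times> J" "?le (i, k) j" for j
      proof -
        have "\<bar>u *\<^sub>R (x (fst j) - f) + v *\<^sub>R (y (snd j) - g)\<bar>
            \<le> \<bar>u *\<^sub>R (x (fst j) - f)\<bar> + \<bar>v *\<^sub>R (y (snd j) - g)\<bar>" by (rule abs_triangle_ineq)
        also have "\<dots> \<le> \<bar>x (fst j) - f\<bar> + \<bar>y (snd j) - g\<bar>"
          using uv by (intro add_mono abs_scaleR_le) auto
        also have "\<dots> \<le> p + q" using i(2)[of "fst j"] k(2)[of "snd j"] j by (intro add_mono) auto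
        finally show ?thesis by (simp add: algebra_simps)
      qed
      then show ?thesis using i(1) k(1) by (intro bexI[of _ "(i, k)"]) auto
    qed
    show "order_converges (I \<times> J) ?le ?z (u *\<^sub>R f + v *\<^sub>R g)"
      unfolding order_converges_def
    proof (intro exI conjI ballI)
      show "(\<lambda>(p, q). p + q) ` (P \<times> Q) \<down> 0" by (rule down_to_add[OF P(1) Q(1)])
      fix r assume "r \<in> (\<lambda>(p, q). p + q) ` (P \<times> Q)"
      then obtain p q where "r = p + q" "p \<in> P" "q \<in> Q" by auto
      then show "\<exists>i\<in>I \<times> J. \<forall>j\<in>I \<times> J. ?le i j \<longrightarrow> \<bar>?z j - (u *\<^sub>R f + v *\<^sub>R g)\<bar> \<le> r"
        using tail by simp
    qed
  qed
qed

text \<open>Convexity and balancedness are automatic, so only the condition on rays remains. A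
  vector of the adherence yields a directed set for its modulus, which is why a general
  \<open>e\<close> is replaced by \<open>\<bar>e\<bar>\<close>.\<close>

lemma radially_bounded_order_adherence_iff:
  fixes \<iota> :: "'f::normed_lattice \<Rightarrow> 'g::vector_lattice"
  assumes emb: "lattice_embedding \<iota>"
    and approx: "\<And>g. 0 \<le> g \<Longrightarrow> isLub UNIV (\<iota> ` {h. 0 \<le> h \<and> \<iota> h \<le> g}) g"
  shows "radially_bounded (order_adherence (\<iota> ` cball 0 1)) \<longleftrightarrow>
    (\<forall>e>0. \<exists>n::nat. \<not> (\<exists>P. P \<subseteq> cball 0 1 \<inter> {0..} \<and> \<iota> ` P \<up> real n *\<^sub>R e))"
proof -
  let ?A = "order_adherence (\<iota> ` cball 0 1)"
  have lin: "linear \<iota>" using emb by (simp add: lattice_embedding_def)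
  have "convex ?A"
    by (intro convex_order_adherence convex_linear_image[OF lin] convex_cball)
  moreover have "balanced (\<iota> ` cball 0 1)"
    unfolding balanced_def by (auto simp: linear_scale[OF lin, symmetric] mult_le_one)
  then have "balanced ?A" by (rule balanced_order_adherence)
  ultimately have "radially_bounded ?A \<longleftrightarrow> (\<forall>e. e \<noteq> 0 \<longrightarrow> (\<exists>n::nat. real n *\<^sub>R e \<notin> ?A))"
    by (simp add: radially_bounded_def)
  also have "\<dots> \<longleftrightarrow> (\<forall>e>0. \<exists>n::nat. \<not> (\<exists>P. P \<subseteq> cball 0 1 \<inter> {0..} \<and> \<iota> ` P \<up> real n *\<^sub>R e))"
  proof (intro iffI allI impI)
    fix e :: 'g assume "\<forall>e. e \<noteq> 0 \<longrightarrow> (\<exists>n::nat. real n *\<^sub>R e \<notin> ?A)" "0 < e"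
    moreover from this have "e \<noteq> 0" by (metis order_less_irrefl)
    ultimately obtain n :: nat where n: "real n *\<^sub>R e \<notin> ?A" by blast
    have "real n *\<^sub>R e \<in> ?A" if "P \<subseteq> cball 0 1 \<inter> {0..}" "\<iota> ` P \<up> real n *\<^sub>R e" for P
      using that by (intro up_to_imp_order_adherence[of "\<iota> ` P"]) auto
    then show "\<exists>n::nat. \<not> (\<exists>P. P \<subseteq> cball 0 1 \<inter> {0..} \<and> \<iota> ` P \<up> real n *\<^sub>R e)"
      using n by blast
  next
    fix e :: 'g
    assume *: "\<forall>e>0. \<exists>n::nat. \<not> (\<exists>P. P \<subseteq> cball 0 1 \<inter> {0..} \<and> \<iota> ` P \<up> real n *\<^sub>R e)"
    assume "e \<noteq> 0"
    then have "0 < \<bar>e\<bar>" by simp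
    then obtain n :: nat where "\<not> (\<exists>P. P \<subseteq> cball 0 1 \<inter> {0..} \<and> \<iota> ` P \<up> real n *\<^sub>R \<bar>e\<bar>)"
      using * by blast
    then show "\<exists>n::nat. real n *\<^sub>R e \<notin> ?A"
      using order_adherence_imp_up_to[OF emb approx, of "real n *\<^sub>R e"]
      by (auto simp: abs_scaleR_nonneg)
  qed
  finally show ?thesis .
qed

section \<open>Reduction of the four conditions to multiples of a single vector\<close>

text \<open>Order density lets \<open>\<iota>\<close> preserve suprema: if an upper bound
  \<open>u\<close> of the image failed to dominate \<open>\<iota> f\<close>, some
  \<open>\<iota> e > 0\<close> would fit into the gap and \<open>f - e\<close> would bound
  \<open>P\<close>.\<close>

lemma embedding_up_to_iff:
  fixes \<iota> :: "'f::vector_lattice \<Rightarrow> 'u::universally_complete_vector_lattice"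
  assumes \<iota>: "universal_completion \<iota>"
  shows "\<iota> ` P \<up> \<iota> f \<longleftrightarrow> P \<up> f"
proof -
  have emb: "lattice_embedding \<iota>" and dense: "order_dense (range \<iota>)"
    using \<iota> by (auto simp: universal_completion_def)
  note simps = lattice_embedding_simps[OF emb]
  have "isLub UNIV (\<iota> ` P) (\<iota> f)" if lub: "isLub UNIV P f"
    unfolding isLub_UNIV_iff
  proof (intro conjI ballI allI impI)
    show "q \<le> \<iota> f" if "q \<in> \<iota> ` P" for q using that lub by (auto simp: isLub_UNIV_iff simps)
    fix u assume u: "\<forall>q\<in>\<iota> ` P. q \<le> u"
    show "\<iota> f \<le> u"
    proof (rule ccontr)
      assume "\<not> \<iota> f \<le> u"
      then have "0 < \<iota> f - inf (\<iota> f) u"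
        by (metis diff_ge_0_iff_ge eq_iff_diff_eq_0 inf.cobounded1 le_iff_inf order_le_less)
      then obtain e where e: "0 < \<iota> e" "\<iota> e \<le> \<iota> f - inf (\<iota> f) u"
        using dense unfolding order_dense_def by blast
      have "p \<le> f - e" if p: "p \<in> P" for p
      proof -
        have "\<iota> p \<le> inf (\<iota> f) u" using p u lub by (auto simp: isLub_UNIV_iff simps)
        also have "\<dots> \<le> \<iota> (f - e)" using e(2) by (simp only: simps le_diff_eq add.commute)
        finally show ?thesis by (simp only: simps(7))
      qed
      then have "f \<le> f - e" using lub by (auto simp: isLub_UNIV_iff)
      then have "\<iota> e \<le> 0" using simps(7)[of e 0] by (simp add: simps(1))
      then show False using e(1) by simp
    qed
  qed
  moreover have "isLub UNIV P f" if lub: "isLub UNIV (\<iota> ` P) (\<iota> f)"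
    unfolding isLub_UNIV_iff
  proof (intro conjI ballI allI impI)
    fix z assume "\<forall>q\<in>P. q \<le> z"
    then have "\<forall>q\<in>\<iota> ` P. q \<le> \<iota> z" by (simp add: simps)
    then have "\<iota> f \<le> \<iota> z" using lub by (simp only: isLub_UNIV_iff)
    then show "f \<le> z" by (simp add: simps)
  qed (use lub in \<open>auto simp: isLub_UNIV_iff simps\<close>)
  moreover have "upward_directed (\<iota> ` P) \<longleftrightarrow> upward_directed P"
    by (simp add: upward_directed_def simps)
  ultimately show ?thesis unfolding up_to_def by blast
qed

text \<open>Truncating further by \<open>h\<close> moves the supremum from \<open>F\<^sup>u\<close>
  into \<open>F\<close>, and solidity of the norm keeps the truncated set in the ball. Only
  truncations of \<open>P\<close> are assumed to have a supremum, so \<open>P\<close> may be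
  unbounded in \<open>F\<^sup>u\<close>.\<close>

lemma ball_sups_of_truncated_lub:
  fixes \<iota> :: "'f::normed_lattice \<Rightarrow> 'u::universally_complete_vector_lattice"
  assumes \<iota>: "universal_completion \<iota>"
    and P: "P \<subseteq> cball 0 1 \<inter> {0..}" "upward_directed P"
    and lub: "isLub UNIV ((\<lambda>p. inf p a) ` \<iota> ` P) a"
    and h: "0 \<le> h" "\<iota> h \<le> a"
  shows "h \<in> ball_sups"
proof -
  have emb: "lattice_embedding \<iota>" using \<iota> by (auto simp: universal_completion_def)
  note simps = lattice_embedding_simps[OF emb]
  let ?P = "(\<lambda>p. inf p h) ` P"
  have "(\<lambda>p. inf p (\<iota> h)) ` (\<lambda>p. inf p a) ` \<iota> ` P = \<iota> ` ?P"
    using h by (simp add: image_image simps inf_assoc inf_absorb2)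
  then have "isLub UNIV (\<iota> ` ?P) (\<iota> h)"
    using isLub_inf_right[OF lub, of "\<iota> h"] h by (simp add: inf_absorb2)
  moreover have "upward_directed ?P"
    using P(2) by (rule upward_directed_image) (auto intro!: monoI intro: le_infI1)
  then have "upward_directed (\<iota> ` ?P)"
    by (rule upward_directed_image) (simp add: mono_def simps)
  ultimately have "?P \<up> h" using embedding_up_to_iff[OF \<iota>] by (auto simp: up_to_def)
  moreover have "?P \<subseteq> cball 0 1 \<inter> {0..}"
  proof
    fix x assume "x \<in> ?P"
    then obtain p where p: "x = inf p h" "p \<in> P" by blast
    then have "0 \<le> p" "norm p \<le> 1" using P(1) by auto
    moreover from this have "norm x \<le> norm p" using h p by (intro norm_solid) simp
    ultimately show "x \<in> cball 0 1 \<inter> {0..}" using p h by simp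
  qed
  ultimately show ?thesis unfolding ball_sups_def by blast
qed

section \<open>Demicontinuity and radial boundedness\<close>

text \<open>Scaling by \<open>n\<close> turns a set increasing to \<open>f\<close> inside
  \<open>s\<close> times the ball into one increasing to \<open>n f\<close>, which lies in the ball
  as soon as \<open>0 \<le> s\<close> and \<open>n s \<le> 1\<close>. So \<open>t\<close> and
  \<open>n\<close> correspond as \<open>t = 1 / n\<close>.\<close>

lemma pointwise_demicontinuous_iff:
  "pointwise_demicontinuous TYPE('f::normed_lattice) \<longleftrightarrow>
    (\<forall>e>0. \<exists>n::nat. real n *\<^sub>R e \<notin> (ball_sups :: 'f set))"
proof (intro iffI allI impI)
  fix e :: 'f assume "pointwise_demicontinuous TYPE('f)" "0 < e"
  then have "\<exists>t>0. \<forall>s P. P \<subseteq> (\<lambda>x. s *\<^sub>R x) ` (cball 0 1 \<inter> {0..}) \<and> P \<up> e \<longrightarrow> t \<le> s"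
    unfolding pointwise_demicontinuous_def by simp
  then obtain t where t: "0 < t"
    "\<forall>s P. P \<subseteq> (\<lambda>x. s *\<^sub>R x) ` (cball 0 1 \<inter> {0..}) \<and> P \<up> e \<longrightarrow> t \<le> s"
    by (elim exE conjE)
  obtain n :: nat where n: "0 < n" "inverse (real n) < t" using ex_inverse_of_nat_less[OF t(1)] by blast
  have "real n *\<^sub>R e \<notin> ball_sups"
  proof
    assume "real n *\<^sub>R e \<in> ball_sups"
    then obtain P where P: "P \<subseteq> cball 0 1 \<inter> {0..}" "P \<up> real n *\<^sub>R e"
      unfolding ball_sups_def by blast
    have "(\<lambda>x. inverse (real n) *\<^sub>R x) ` P \<up> e"
      using up_to_scaleR[OF P(2), of "inverse (real n)"] n by simp
    moreover have "(\<lambda>x. inverse (real n) *\<^sub>R x) ` P \<subseteq> (\<lambda>x. inverse (real n) *\<^sub>R x) ` (cball 0 1 \<inter> {0..})"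
      using P(1) by (rule image_mono)
    ultimately have "t \<le> inverse (real n)" using t(2) by blast
    then show False using n by simp
  qed
  then show "\<exists>n::nat. real n *\<^sub>R e \<notin> ball_sups" by blast
next
  assume *: "\<forall>e>0. \<exists>n::nat. real n *\<^sub>R e \<notin> (ball_sups :: 'f set)"
  show "pointwise_demicontinuous TYPE('f)"
    unfolding pointwise_demicontinuous_def
  proof (intro allI impI)
    fix f :: 'f assume f: "0 < f"
    then obtain n :: nat where n: "real n *\<^sub>R f \<notin> ball_sups" using * by blast
    \<comment> \<open>This excludes \<open>n = 0\<close>, so that \<open>1 / n\<close> can serve as
      the threshold.\<close>
    have "(0::'f) \<in> ball_sups"
      unfolding ball_sups_def
      by (auto simp: up_to_def upward_directed_def isLub_UNIV_iff intro!: exI[of _ "{0}"])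
    then have n0: "0 < n" using n by (cases n) auto
    have "inverse (real n) \<le> s" if P: "P \<subseteq> (\<lambda>x. s *\<^sub>R x) ` (cball 0 1 \<inter> {0..})" "P \<up> f" for s P
    proof (rule ccontr)
      assume "\<not> inverse (real n) \<le> s"
      then have s: "real n * s \<le> 1" using n0 by (simp add: field_simps)
      \<comment> \<open>The definition ranges over all real \<open>s\<close>; a negative one would
        put \<open>P\<close> below zero, against \<open>0 < f\<close>.\<close>
      have "0 \<le> s"
      proof (rule ccontr)
        assume "\<not> 0 \<le> s"
        then have "p \<le> 0" if "p \<in> P" for p
          using that P(1) by (auto intro!: scaleR_nonpos_nonneg)
        then have "f \<le> 0" using P(2) by (auto simp: up_to_def isLub_UNIV_iff)
        then show False using f by simp
      qed
      have "(\<lambda>x. real n *\<^sub>R x) ` P \<up> real n *\<^sub>R f" using up_to_scaleR[OF P(2)] n0 by simp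
      moreover have "(\<lambda>x. real n *\<^sub>R x) ` P \<subseteq> cball 0 1 \<inter> {0..}"
      proof
        fix y assume "y \<in> (\<lambda>x. real n *\<^sub>R x) ` P"
        then obtain p where p: "y = real n *\<^sub>R p" "p \<in> P" by blast
        then have "p \<in> (\<lambda>x. s *\<^sub>R x) ` (cball 0 1 \<inter> {0..})" using P(1) by blast
        then obtain x where px: "p = s *\<^sub>R x" and "x \<in> cball 0 1 \<inter> {0..}" by (rule imageE)
        then have x: "norm x \<le> 1" "0 \<le> x" by auto
        have y: "y = (real n * s) *\<^sub>R x" using p px by simp
        then have "norm y \<le> 1" using x y s \<open>0 \<le> s\<close> by (simp add: abs_mult mult_le_one)
        moreover have "0 \<le> y" using x y \<open>0 \<le> s\<close> by (simp add: scaleR_nonneg_nonneg)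
        ultimately show "y \<in> cball 0 1 \<inter> {0..}" by simp
      qed
      ultimately show False using n unfolding ball_sups_def by blast
    qed
    then show "\<exists>t>0. \<forall>s P. P \<subseteq> (\<lambda>x. s *\<^sub>R x) ` (cball 0 1 \<inter> {0..}) \<and> P \<up> f \<longrightarrow> t \<le> s"
      using n0 by (intro exI[of _ "inverse (real n)"]) auto
  qed
qed

lemma radially_bounded_adherence_iff:
  "radially_bounded (order_adherence (cball 0 1 :: 'f::normed_lattice set)) \<longleftrightarrow>
    (\<forall>e>0. \<exists>n::nat. real n *\<^sub>R e \<notin> (ball_sups :: 'f set))"
proof -
  have "radially_bounded (order_adherence (id ` cball 0 1 :: 'f set)) \<longleftrightarrow>
    (\<forall>e>0. \<exists>n::nat. \<not> (\<exists>P. P \<subseteq> cball 0 1 \<inter> {0..} \<and> id ` P \<up> real n *\<^sub>R (e :: 'f)))"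
    by (rule radially_bounded_order_adherence_iff)
      (auto simp: lattice_embedding_def isLub_UNIV_iff linear_id)
  then show ?thesis by (simp add: ball_sups_def)
qed

text \<open>Below a vector \<open>g > 0\<close> of \<open>F\<^sup>u\<close> density provides
  \<open>\<iota> e > 0\<close>; if \<open>n g\<close> is a supremum of a directed set from the ball,
  truncation by \<open>n e\<close> puts \<open>n e\<close> into \<open>ball_sups\<close>. Conversely
  it suffices to take \<open>g = \<iota> e\<close>.\<close>

lemma radially_bounded_image_adherence_iff:
  fixes \<iota> :: "'f::normed_lattice \<Rightarrow> 'u::universally_complete_vector_lattice"
  assumes \<iota>: "universal_completion \<iota>"
  shows "radially_bounded (order_adherence (\<iota> ` cball 0 1)) \<longleftrightarrow>
    (\<forall>e>0. \<exists>n::nat. real n *\<^sub>R e \<notin> (ball_sups :: 'f set))"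
proof -
  have emb: "lattice_embedding \<iota>" and dense: "order_dense (range \<iota>)" and lin: "linear \<iota>"
    using \<iota> by (auto simp: universal_completion_def lattice_embedding_def)
  note simps = lattice_embedding_simps[OF emb]
  let ?B = "\<lambda>g. \<exists>P. P \<subseteq> cball 0 1 \<inter> {0..} \<and> \<iota> ` P \<up> g"
  have "radially_bounded (order_adherence (\<iota> ` cball 0 1)) \<longleftrightarrow> (\<forall>g>0. \<exists>n::nat. \<not> ?B (real n *\<^sub>R g))"
    by (rule radially_bounded_order_adherence_iff[OF emb order_dense_isLub[OF \<iota>]])
  also have "\<dots> \<longleftrightarrow> (\<forall>e>0. \<exists>n::nat. real n *\<^sub>R e \<notin> (ball_sups :: 'f set))"
  proof (intro iffI allI impI)
    fix e :: 'f assume "\<forall>g>0. \<exists>n::nat. \<not> ?B (real n *\<^sub>R g)" "0 < e"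
    moreover from this have "0 < \<iota> e" using simps(7)[of 0 e] simps(7)[of e 0]
      by (simp add: less_le_not_le simps(1))
    ultimately obtain n :: nat where "\<not> ?B (\<iota> (real n *\<^sub>R e))" by (metis linear_scale[OF lin])
    then show "\<exists>n::nat. real n *\<^sub>R e \<notin> ball_sups"
      by (auto simp: ball_sups_def embedding_up_to_iff[OF \<iota>])
  next
    fix g :: 'u assume *: "\<forall>e>0. \<exists>n::nat. real n *\<^sub>R e \<notin> (ball_sups :: 'f set)" and "0 < g"
    then obtain e where e: "0 < \<iota> e" "\<iota> e \<le> g" using dense by (auto simp: order_dense_def)
    then have e0: "0 < e" using simps(7)[of 0 e] simps(7)[of e 0]
      by (simp add: less_le_not_le simps(1))
    then obtain n :: nat where n: "real n *\<^sub>R e \<notin> ball_sups" using * by blast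
    have "\<not> ?B (real n *\<^sub>R g)"
    proof
      assume "?B (real n *\<^sub>R g)"
      then obtain P where P: "P \<subseteq> cball 0 1 \<inter> {0..}" "\<iota> ` P \<up> real n *\<^sub>R g" by blast
      have "upward_directed P" using P(2) by (simp add: up_to_def upward_directed_def simps)
      moreover have "isLub UNIV ((\<lambda>p. inf p (real n *\<^sub>R g)) ` \<iota> ` P) (real n *\<^sub>R g)"
        using P(2) isLub_inf_right[of "\<iota> ` P" "real n *\<^sub>R g" "real n *\<^sub>R g"] by (simp add: up_to_def)
      moreover have "\<iota> (real n *\<^sub>R e) \<le> real n *\<^sub>R g"
        using e by (simp add: linear_scale[OF lin] scaleR_left_mono)
      ultimately have "real n *\<^sub>R e \<in> ball_sups"
        using P(1) e0 by (intro ball_sups_of_truncated_lub[OF \<iota>]) (auto simp: scaleR_nonneg_nonneg)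
      then show False using n by blast
    qed
    then show "\<exists>n::nat. \<not> ?B (real n *\<^sub>R g)" by blast
  qed
  finally show ?thesis .
qed

section \<open>Domination of directed sets\<close>

text \<open>Summing the sets \<open>P k \<up> (2 ^ (k + 1) * k) e\<close> with weights \<open>2 ^ - (k + 1)\<close> keeps the norms below
  \<open>1\<close>, while any upper bound of the sums dominates every \<open>k e\<close>.\<close>

lemma exists_directed_undominated:
  fixes \<iota> :: "'f::normed_lattice \<Rightarrow> 'u::universally_complete_vector_lattice" and e :: 'f
  assumes \<iota>: "universal_completion \<iota>" and e: "0 < e"
    and sups: "\<And>n::nat. real n *\<^sub>R e \<in> ball_sups"
  shows "\<exists>D. D \<subseteq> cball 0 1 \<inter> {0..} \<and> upward_directed D \<and> \<not> bdd_above (\<iota> ` D)"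
proof -
  have emb: "lattice_embedding \<iota>" and lin: "linear \<iota>"
    using \<iota> by (auto simp: universal_completion_def lattice_embedding_def)
  note simps = lattice_embedding_simps[OF emb]
  define c :: "nat \<Rightarrow> real" where "c k = (1 / 2) ^ Suc k" for k
  have c0: "0 < c k" for k by (simp add: c_def)
  \<comment> \<open>The factor \<open>real k / c k\<close> is the natural number
    \<open>2 ^ Suc k * k\<close>, so \<open>sups\<close> applies.\<close>
  have "\<exists>P. P \<subseteq> cball 0 1 \<inter> {0..} \<and> P \<up> (real k / c k) *\<^sub>R e" for k
    using sups[of "2 ^ Suc k * k"] by (simp add: ball_sups_def c_def field_simps)
  then obtain P where P: "\<And>k. P k \<subseteq> cball 0 1 \<inter> {0..}" "\<And>k. P k \<up> (real k / c k) *\<^sub>R e" by metis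
  have P0: "0 \<le> p" and P1: "norm p \<le> 1" if "p \<in> P k" for p k using P(1)[of k] that by auto
  have "\<exists>p. p \<in> P k" for k using P(2)[of k] by (auto simp: up_to_def upward_directed_def)
  then obtain p0 where p0: "\<And>k. p0 k \<in> P k" by metis
  define S where "S m p = (\<Sum>k<m. c k *\<^sub>R p k)" for m :: nat and p :: "nat \<Rightarrow> 'f"
  \<comment> \<open>Entries and length are chosen freely. Two sums lie below the sum of entrywise
    upper bounds up to the larger length, since the added terms are nonnegative.\<close>
  define D where "D = {S m p | m p. \<forall>k. p k \<in> P k}"
  have S0: "0 \<le> S m p" if "\<And>k. p k \<in> P k" for m p
    unfolding S_def using P0[OF that] c0 by (intro sum_nonneg scaleR_nonneg_nonneg) (auto simp: less_imp_le)
  have S1: "norm (S m p) \<le> 1 - (1 / 2) ^ m" if p: "\<And>k. p k \<in> P k" for m p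
  proof (induction m)
    case 0
    then show ?case by (simp add: S_def)
  next
    case (Suc m)
    have "norm (S (Suc m) p) \<le> norm (S m p) + norm (c m *\<^sub>R p m)"
      by (simp only: S_def sum.lessThan_Suc norm_triangle_ineq)
    also have "norm (c m *\<^sub>R p m) \<le> c m" using P1[OF p, of m] c0[of m] by (simp add: mult_left_le)
    finally show ?case using Suc by (simp add: c_def)
  qed
  have "D \<subseteq> cball 0 1 \<inter> {0..}"
  proof
    fix x assume "x \<in> D"
    then obtain m p where x: "x = S m p" "\<And>k. p k \<in> P k" by (auto simp: D_def)
    have "(0::real) \<le> (1 / 2) ^ m" by simp
    then have "norm x \<le> 1" using S1[OF x(2), of m] unfolding x(1) by linarith
    then show "x \<in> cball 0 1 \<inter> {0..}" using S0[OF x(2)] x(1) by simp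
  qed
  moreover have "upward_directed D"
    unfolding upward_directed_def
  proof (intro conjI ballI)
    show "D \<noteq> {}" using p0 by (auto simp: D_def)
    fix x y assume "x \<in> D" "y \<in> D"
    then obtain m p n q where xy: "x = S m p" "y = S n q" "\<And>k. p k \<in> P k" "\<And>k. q k \<in> P k"
      by (auto simp: D_def)
    have "\<exists>r\<in>P k. p k \<le> r \<and> q k \<le> r" for k
      using P(2) xy by (auto simp: up_to_def upward_directed_def)
    then obtain r where r: "\<And>k. r k \<in> P k" "\<And>k. p k \<le> r k" "\<And>k. q k \<le> r k" by metis
    have mono: "S i p' \<le> S (max m n) r" if "i \<le> max m n" "\<And>k. p' k \<le> r k" for i p'
    proof -
      have "S i p' \<le> S i r" unfolding S_def
        using that c0 by (intro sum_mono scaleR_left_mono) (auto simp: less_imp_le)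
      also have "\<dots> \<le> S (max m n) r" unfolding S_def
        using that c0 P0[OF r(1)] by (intro sum_mono2) (auto simp: less_imp_le scaleR_nonneg_nonneg)
      finally show ?thesis .
    qed
    show "\<exists>z\<in>D. x \<le> z \<and> y \<le> z"
      using r xy(1,2) mono[of m p] mono[of n q] by (intro bexI[of _ "S (max m n) r"]) (auto simp: D_def)
  qed
  moreover have "\<not> bdd_above (\<iota> ` D)"
  proof
    assume "bdd_above (\<iota> ` D)"
    then obtain g where g: "\<And>d. d \<in> D \<Longrightarrow> \<iota> d \<le> g" by (auto simp: bdd_above_def)
    have "real k *\<^sub>R \<iota> e \<le> g" for k :: nat
    proof -
      have "\<iota> p \<le> g /\<^sub>R c k" if p: "p \<in> P k" for p
      proof -
        \<comment> \<open>The given \<open>p\<close> is placed at index \<open>k\<close> among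
          arbitrary other entries, so \<open>c k *\<^sub>R p\<close> is one term of a nonnegative
          sum in \<open>D\<close>.\<close>
        let ?p = "p0(k := p)"
        have mem: "\<And>j. ?p j \<in> P j" using p0 p by simp
        have "c k *\<^sub>R ?p k \<le> S (Suc k) ?p"
          using S0[OF mem, of k] by (simp add: S_def)
        then have "\<iota> (c k *\<^sub>R p) \<le> \<iota> (S (Suc k) ?p)" by (simp add: simps)
        moreover have "S (Suc k) ?p \<in> D" unfolding D_def using mem by blast
        then have "\<iota> (S (Suc k) ?p) \<le> g" by (rule g)
        ultimately have "\<iota> (c k *\<^sub>R p) \<le> g" by (rule order_trans)
        then show ?thesis using c0[of k] by (simp add: linear_scale[OF lin] scaleR_le_iff)
      qed
      moreover have "\<iota> ` P k \<up> \<iota> ((real k / c k) *\<^sub>R e)" using P(2) by (simp add: embedding_up_to_iff[OF \<iota>])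
      ultimately have "\<iota> ((real k / c k) *\<^sub>R e) \<le> g /\<^sub>R c k" by (auto simp: up_to_def isLub_UNIV_iff)
      then show ?thesis
        using c0[of k] by (simp add: linear_scale[OF lin] flip: scaleR_le_iff)
    qed
    then have "\<iota> e \<le> \<iota> 0" unfolding simps(1) by (rule universally_complete_archimedean)
    then show False using e by (simp only: simps(7))
  qed
  ultimately show ?thesis by (intro exI conjI)
qed

text \<open>An unbounded directed set yields a direction \<open>g\<close> in
  \<open>F\<^sup>u\<close> by \<open>exists_unbounded_direction\<close>; density and truncation
  replace it by some \<open>e\<close> in \<open>F\<close>. The other direction is
  \<open>exists_directed_undominated\<close>.\<close>

lemma directed_dominable_iff:
  fixes \<iota> :: "'f::normed_lattice \<Rightarrow> 'u::universally_complete_vector_lattice"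
  assumes \<iota>: "universal_completion \<iota>"
  shows "(\<forall>P :: 'f set. P \<subseteq> cball 0 1 \<inter> {0..} \<and> upward_directed P \<longrightarrow> dominable \<iota> P) \<longleftrightarrow>
    (\<forall>e>0. \<exists>n::nat. real n *\<^sub>R e \<notin> (ball_sups :: 'f set))"
proof (intro iffI allI impI)
  fix e :: 'f
  assume dom: "\<forall>P :: 'f set. P \<subseteq> cball 0 1 \<inter> {0..} \<and> upward_directed P \<longrightarrow> dominable \<iota> P"
    and e: "0 < e"
  show "\<exists>n::nat. real n *\<^sub>R e \<notin> ball_sups"
  proof (rule ccontr)
    assume "\<not> ?thesis"
    then have "real n *\<^sub>R e \<in> ball_sups" for n :: nat by simp
    from exists_directed_undominated[OF \<iota> e this]
    obtain D :: "'f set" where "D \<subseteq> cball 0 1 \<inter> {0..}" "upward_directed D" "\<not> bdd_above (\<iota> ` D)"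
      by (elim exE conjE)
    then show False using dom by (simp add: dominable_def)
  qed
next
  fix P :: "'f set"
  assume *: "\<forall>e>0. \<exists>n::nat. real n *\<^sub>R e \<notin> (ball_sups :: 'f set)"
    and P: "P \<subseteq> cball 0 1 \<inter> {0..} \<and> upward_directed P"
  have emb: "lattice_embedding \<iota>" and dense: "order_dense (range \<iota>)" and lin: "linear \<iota>"
    using \<iota> by (auto simp: universal_completion_def lattice_embedding_def)
  note simps = lattice_embedding_simps[OF emb]
  have pos: "0 \<le> p" if "p \<in> \<iota> ` P" for p
    using that P simps(7)[of 0] by (auto simp: simps(1))
  have "bdd_above (\<iota> ` P)"
  proof (rule ccontr)
    assume "\<not> bdd_above (\<iota> ` P)"
    with pos have "\<exists>g>0. \<forall>n::nat. isLub UNIV ((\<lambda>p. inf p (real n *\<^sub>R g)) ` \<iota> ` P) (real n *\<^sub>R g)"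
      by (rule exists_unbounded_direction)
    then obtain g where g: "0 < g"
      "\<forall>n::nat. isLub UNIV ((\<lambda>p. inf p (real n *\<^sub>R g)) ` \<iota> ` P) (real n *\<^sub>R g)"
      by (elim exE conjE)
    obtain e where e: "0 < \<iota> e" "\<iota> e \<le> g" using dense g(1) by (auto simp: order_dense_def)
    then have e0: "0 < e" using simps(7)[of 0 e] simps(7)[of e 0]
      by (simp add: less_le_not_le simps(1))
    have "real n *\<^sub>R e \<in> ball_sups" for n :: nat
    proof (rule ball_sups_of_truncated_lub[OF \<iota> _ _ g(2)[rule_format]])
      show "\<iota> (real n *\<^sub>R e) \<le> real n *\<^sub>R g"
        using e by (simp add: linear_scale[OF lin] scaleR_left_mono)
    qed (use P e0 in \<open>auto simp: scaleR_nonneg_nonneg\<close>)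
    then show False using * e0 by blast
  qed
  moreover have "bdd_below (\<iota> ` P)" using pos by (intro bdd_belowI[of _ 0])
  ultimately show "dominable \<iota> P" by (simp add: dominable_def)
qed

text \<open>The common adherences appear as order adherences;
  \<open>order_adherence_image_cball_eq_uo_adherence\<close> and
  \<open>order_adherence_cball_eq_uo_adherence\<close> identify them with the uo adherences.\<close>

theorem proposition4p6:
  fixes \<iota> :: "'f::normed_lattice \<Rightarrow> 'u::universally_complete_vector_lattice"
  assumes "universal_completion \<iota>"
  shows "(pointwise_demicontinuous TYPE('f) \<longleftrightarrow>
            radially_bounded (order_adherence (\<iota> ` cball 0 1))) \<and>
         (pointwise_demicontinuous TYPE('f) \<longleftrightarrow>
            radially_bounded (order_adherence (cball 0 1 :: 'f set))) \<and>
         (pointwise_demicontinuous TYPE('f) \<longleftrightarrow>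
            (\<forall>P :: 'f set. P \<subseteq> cball 0 1 \<inter> {0..} \<and> upward_directed P \<longrightarrow> dominable \<iota> P))"
  unfolding pointwise_demicontinuous_iff radially_bounded_adherence_iff
    radially_bounded_image_adherence_iff[OF assms] directed_dominable_iff[OF assms]
  by simp

end
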